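(* For any integer $n\ge 1$, the variety $\mathsf{V}(\mathbb{Z}_n^\dag)$ is a cover of the variety $\mathsf{BA}$ of Boolean algebras (in the lattice of varieties of pseudo BL-algebras), and for integers $n,m\ge 1$, $n\ne m$ implies $\mathsf{V}(\mathbb{Z}_n^\dag)\ne\mathsf{V}(\mathbb{Z}_m^\dag)$.
   Context: An FL-algebra is an algebra $\langle A;\wedge,\vee,\backslash,/,\cdot,0,1\rangle$ where $\langle A;\wedge,\vee\rangle$ is a lattice, $\langle A;\cdot,1\rangle$ a monoid, $xy\le z\iff y\le x\backslash z\iff x\le z/y$, and $0\in A$. A pseudo BL-algebra is an FL-algebra with $0\le x\le 1$, $x(x\backslash(x\wedge y))=x\wedge y=((x\wedge y)/x)x$, and $x\backslash y\vee y\backslash x=1=y/x\vee x/y$. Boolean algebras are regarded as pseudo BL-algebras ($\cdot=\wedge$, both divisions being implication); $\mathsf{BA}$ is the variety generated by the two-element one. $\mathsf{V}(\mathbf{A})$ is the variety generated by $\mathbf{A}$. A variety $\mathsf{W}$ covers $\mathsf{BA}$ if $\mathsf{BA}\subsetneq\mathsf{W}$ and no variety lies strictly between them. Kites. Let $\mathbf{G}$ be an $\ell$-group (written multiplicatively, identity $e$), $G^+=\{g: g\ge e\}$, $G^-=\{g: g\le e\}$. Let $I,J$ be sets with $|J|\le|I|$ and $\lambda,\rho\colon J\to I$ injections. The kite $K_{I,J}^{\lambda,\rho}(\mathbf{G})$ is the algebra $\langle (G^+)^J\uplus(G^-)^I;\vee,\wedge,\cdot,\backslash,/,1,0\rangle$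 (disjoint union) whose order is coordinatewise inside $(G^+)^J$ and inside $(G^-)^I$, with every element of $(G^+)^J$ below every element of $(G^-)^I$. Elements of $(G^-)^I$ are written $\langle a_i^{-1}\rangle_{i\in I}$ with $a_i\in G^+$, elements of $(G^+)^J$ as $\langle f_j\rangle_{j\in J}$; $e^{-1}$ denotes $e$ as an element of $G^-$. $1$ is the constant sequence $e^{-1}$ in $(G^-)^I$ and $0$ the constant sequence $e$ in $(G^+)^J$. Multiplication: $\langle a_i^{-1}\rangle\cdot\langle b_i^{-1}\rangle=\langle (b_ia_i)^{-1}\rangle$; $\langle a_i^{-1}\rangle\cdot\langle f_j\rangle=\langle a_{\lambda(j)}^{-1}f_j\vee e\rangle_{j\in J}$; $\langle f_j\rangle\cdot\langle a_i^{-1}\rangle=\langle f_ja_{\rho(j)}^{-1}\vee e\rangle_{j\in J}$; $\langle f_j\rangle\cdot\langle g_j\rangle=0$. Divisions: $\langle a_i^{-1}\rangle\backslash\langle b_i^{-1}\rangle=\langle a_ib_i^{-1}\wedge e^{-1}\rangle$; $\langle b_i^{-1}\rangle/\langle a_i^{-1}\rangle=\langle b_i^{-1}a_i\wedge e^{-1}\rangle$; $\langle a_i^{-1}\rangle\backslash\langle f_j\rangle=\langle a_{\lambda(j)}f_j\rangle_{j}$; $\langle f_j\rangle/\langle a_i^{-1}\rangle=\langle f_ja_{\rho(j)}\rangle_{j}$; $\langle f_j\rangle\backslash\langle g_j\rangle$ is the element of $(G^-)^I$ whose $i$-th coordinate is $f_{\rho^{-1}(i)}^{-1}g_{\rho^{-1}(i)}\wedge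 e^{-1}$ if $i\in\rho(J)$ and $e^{-1}$ otherwise; $\langle g_j\rangle/\langle f_j\rangle$ is the element of $(G^-)^I$ whose $i$-th coordinate is $g_{\lambda^{-1}(i)}f_{\lambda^{-1}(i)}^{-1}\wedge e^{-1}$ if $i\in\lambda(J)$ and $e^{-1}$ otherwise; $\langle a_i^{-1}\rangle/\langle f_j\rangle=1=\langle f_j\rangle\backslash\langle a_i^{-1}\rangle$. For an integer $n\ge 1$ let $J_n=\{1,\dots,n\}$, $I_n=\{1,\dots,n,n+1\}$, $\lambda_n,\rho_n\colon J_n\to I_n$, $\lambda_n(i)=i$, $\rho_n(i)=i+1$, and $\mathbb{Z}_n^\dag=K_{I_n,J_n}^{\lambda_n,\rho_n}(\mathbb{Z})$, where $\mathbb{Z}$ is the additive $\ell$-group of integers with its usual order. *)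

theory Defs
  imports "HOL-Algebra.Group" "HOL-Library.FuncSet"
begin

section \<open>FL-algebras and pseudo BL-algebras\<close>

record 'a fl = "'a monoid" +
  fl_meet :: "'a \<Rightarrow> 'a \<Rightarrow> 'a" (infixl "\<^bold>\<and>\<index>" 70)
  fl_join :: "'a \<Rightarrow> 'a \<Rightarrow> 'a" (infixl "\<^bold>\<or>\<index>" 65)
  fl_ldiv :: "'a \<Rightarrow> 'a \<Rightarrow> 'a" (infixl "\<setminus>\<index>" 70)
  fl_rdiv :: "'a \<Rightarrow> 'a \<Rightarrow> 'a" (infixl "\<^bold>'/\<index>" 70)
  fl_zero :: 'a

definition fl_le :: "('a, 'b) fl_scheme \<Rightarrow> 'a \<Rightarrow> 'a \<Rightarrow> bool" where
  "fl_le A x y \<longleftrightarrow> x \<^bold>\<and>\<^bsub>A\<^esub> y = x"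

locale fl_structure =
  fixes A :: "('a, 'b) fl_scheme" (structure)
  assumes one_in: "\<one> \<in> carrier A"
    and zero_in: "fl_zero A \<in> carrier A"
    and mult_in: "\<lbrakk>x \<in> carrier A; y \<in> carrier A\<rbrakk> \<Longrightarrow> x \<otimes> y \<in> carrier A"
    and meet_in: "\<lbrakk>x \<in> carrier A; y \<in> carrier A\<rbrakk> \<Longrightarrow> x \<^bold>\<and> y \<in> carrier A"
    and join_in: "\<lbrakk>x \<in> carrier A; y \<in> carrier A\<rbrakk> \<Longrightarrow> x \<^bold>\<or> y \<in> carrier A"
    and ldiv_in: "\<lbrakk>x \<in> carrier A; y \<in> carrier A\<rbrakk> \<Longrightarrow> x \<setminus> y \<in> carrier A"
    and rdiv_in: "\<lbrakk>x \<in> carrier A; y \<in> carrier A\<rbrakk> \<Longrightarrow> x \<^bold>/ y \<in> carrier A"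

locale fl_algebra = fl_structure A + monoid A for A :: "('a, 'b) fl_scheme" (structure) +
  assumes meet_comm: "\<lbrakk>x \<in> carrier A; y \<in> carrier A\<rbrakk> \<Longrightarrow> x \<^bold>\<and> y = y \<^bold>\<and> x"
    and join_comm: "\<lbrakk>x \<in> carrier A; y \<in> carrier A\<rbrakk> \<Longrightarrow> x \<^bold>\<or> y = y \<^bold>\<or> x"
    and meet_assoc: "\<lbrakk>x \<in> carrier A; y \<in> carrier A; z \<in> carrier A\<rbrakk>
      \<Longrightarrow> (x \<^bold>\<and> y) \<^bold>\<and> z = x \<^bold>\<and> (y \<^bold>\<and> z)"
    and join_assoc: "\<lbrakk>x \<in> carrier A; y \<in> carrier A; z \<in> carrier A\<rbrakk>
      \<Longrightarrow> (x \<^bold>\<or> y) \<^bold>\<or> z = x \<^bold>\<or> (y \<^bold>\<or> z)"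
    and meet_absorb: "\<lbrakk>x \<in> carrier A; y \<in> carrier A\<rbrakk> \<Longrightarrow> x \<^bold>\<and> (x \<^bold>\<or> y) = x"
    and join_absorb: "\<lbrakk>x \<in> carrier A; y \<in> carrier A\<rbrakk> \<Longrightarrow> x \<^bold>\<or> (x \<^bold>\<and> y) = x"
    and ldiv_residual: "\<lbrakk>x \<in> carrier A; y \<in> carrier A; z \<in> carrier A\<rbrakk>
      \<Longrightarrow> fl_le A (x \<otimes> y) z \<longleftrightarrow> fl_le A y (x \<setminus> z)"
    and rdiv_residual: "\<lbrakk>x \<in> carrier A; y \<in> carrier A; z \<in> carrier A\<rbrakk>
      \<Longrightarrow> fl_le A (x \<otimes> y) z \<longleftrightarrow> fl_le A x (z \<^bold>/ y)"

locale pseudo_BL_algebra = fl_algebra A for A :: "('a, 'b) fl_scheme" (structure) +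
  assumes zero_le: "x \<in> carrier A \<Longrightarrow> fl_le A (fl_zero A) x"
    and le_one: "x \<in> carrier A \<Longrightarrow> fl_le A x \<one>"
    and ldiv_divisible: "\<lbrakk>x \<in> carrier A; y \<in> carrier A\<rbrakk>
      \<Longrightarrow> x \<otimes> (x \<setminus> (x \<^bold>\<and> y)) = x \<^bold>\<and> y"
    and rdiv_divisible: "\<lbrakk>x \<in> carrier A; y \<in> carrier A\<rbrakk>
      \<Longrightarrow> ((x \<^bold>\<and> y) \<^bold>/ x) \<otimes> x = x \<^bold>\<and> y"
    and ldiv_prelinear: "\<lbrakk>x \<in> carrier A; y \<in> carrier A\<rbrakk>
      \<Longrightarrow> (x \<setminus> y) \<^bold>\<or> (y \<setminus> x) = \<one>"
    and rdiv_prelinear: "\<lbrakk>x \<in> carrier A; y \<in> carrier A\<rbrakk>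
      \<Longrightarrow> (y \<^bold>/ x) \<^bold>\<or> (x \<^bold>/ y) = \<one>"


section \<open>Varieties\<close>

datatype fl_term =
    Var nat
  | Zero
  | One
  | Meet fl_term fl_term
  | Join fl_term fl_term
  | Mult fl_term fl_term
  | Ldiv fl_term fl_term
  | Rdiv fl_term fl_term

primrec fl_eval :: "('a, 'b) fl_scheme \<Rightarrow> (nat \<Rightarrow> 'a) \<Rightarrow> fl_term \<Rightarrow> 'a" where
  "fl_eval A v (Var k) = v k"
| "fl_eval A v Zero = fl_zero A"
| "fl_eval A v One = \<one>\<^bsub>A\<^esub>"
| "fl_eval A v (Meet s t) = fl_eval A v s \<^bold>\<and>\<^bsub>A\<^esub> fl_eval A v t"
| "fl_eval A v (Join s t) = fl_eval A v s \<^bold>\<or>\<^bsub>A\<^esub> fl_eval A v t"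
| "fl_eval A v (Mult s t) = fl_eval A v s \<otimes>\<^bsub>A\<^esub> fl_eval A v t"
| "fl_eval A v (Ldiv s t) = fl_eval A v s \<setminus>\<^bsub>A\<^esub> fl_eval A v t"
| "fl_eval A v (Rdiv s t) = fl_eval A v s \<^bold>/\<^bsub>A\<^esub> fl_eval A v t"

type_synonym fl_identity = "fl_term \<times> fl_term"

definition satisfies :: "('a, 'b) fl_scheme \<Rightarrow> fl_identity set \<Rightarrow> bool" where
  "satisfies A E \<longleftrightarrow>
    (\<forall>(s, t) \<in> E. \<forall>v. range v \<subseteq> carrier A \<longrightarrow> fl_eval A v s = fl_eval A v t)"

text \<open>
  A variety is the class of all models of a set of identities. HOL has no proper classes of
  algebras, so the algebras range over all those whose carrier is a subset of a type \<open>'u\<close>.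
  As soon as \<open>'u\<close> is infinite nothing is lost: a variety is determined by its finitely generated
  members, these are countable because the signature is finite, and so each has an isomorphic copy
  inside \<open>'u\<close>.
\<close>

definition Mod :: "fl_identity set \<Rightarrow> 'u fl set" where
  "Mod E = {A. fl_structure A \<and> satisfies A E}"

definition variety :: "'u fl set \<Rightarrow> bool" where
  "variety W \<longleftrightarrow> (\<exists>E. W = Mod E)"

text \<open>
  The generated variety is the intersection of all varieties containing the generating algebra.
  The generator may live on a type other than \<open>'u\<close>; it belongs to the variety
  axiomatised by \<open>E\<close> iff it satisfies \<open>E\<close>.
\<close>

definition variety_gen :: "('a, 'b) fl_scheme \<Rightarrow> 'u fl set" where
  "variety_gen A = \<Inter>{Mod E |E. satisfies A E}"

definition pseudo_BL_variety :: "'u fl set \<Rightarrow> bool" where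
  "pseudo_BL_variety W \<longleftrightarrow> variety W \<and> (\<forall>A \<in> W. pseudo_BL_algebra A)"

definition variety_covers :: "'u fl set \<Rightarrow> 'u fl set \<Rightarrow> bool" where
  "variety_covers W V \<longleftrightarrow>
    pseudo_BL_variety V \<and> pseudo_BL_variety W \<and> V \<subset> W \<and>
    \<not> (\<exists>U. pseudo_BL_variety U \<and> V \<subset> U \<and> U \<subset> W)"

definition two :: "bool fl" where
  "two = \<lparr>carrier = UNIV, monoid.mult = (\<and>), one = True,
    fl_meet = (\<and>), fl_join = (\<or>),
    fl_ldiv = (\<lambda>x y. x \<longrightarrow> y), fl_rdiv = (\<lambda>y x. x \<longrightarrow> y), fl_zero = False\<rparr>"

definition BA :: "'u fl set" where
  "BA = variety_gen two"


section \<open>Kites\<close>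

text \<open>Not necessarily commutative \<open>\<ell>\<close>-groups, written additively.\<close>

class l_group = group_add + lattice +
  assumes l_group_add_left_mono: "a \<le> b \<Longrightarrow> c + a \<le> c + b"
    and l_group_add_right_mono: "a \<le> b \<Longrightarrow> a + c \<le> b + c"

instance int :: l_group
  by standard auto

text \<open>
  \<open>Inl f\<close> is the sequence \<open>\<langle>f\<^sub>j\<rangle>\<close> over the positive cone and \<open>Inr x\<close> is the sequence
  \<open>\<langle>a\<^sub>i\<^sup>-\<^sup>1\<rangle>\<close> over the negative cone, with \<open>x i\<close> standing for \<open>a\<^sub>i\<^sup>-\<^sup>1\<close>; thus \<open>a\<^sub>i\<close> is \<open>- x i\<close> in the
  formulas below. Sequences are extensional functions. The index maps \<open>l\<close> and \<open>r\<close> (for \<open>\<lambda>\<close> and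
  \<open>\<rho>\<close>) are meant to be injections of \<open>J\<close> into \<open>I\<close>.
\<close>

type_synonym ('i, 'j, 'g) kite = "('j \<Rightarrow> 'g) + ('i \<Rightarrow> 'g)"

definition kite_carrier :: "'i set \<Rightarrow> 'j set \<Rightarrow> ('i, 'j, 'g::l_group) kite set" where
  "kite_carrier I J = (J \<rightarrow>\<^sub>E {g. 0 \<le> g}) <+> (I \<rightarrow>\<^sub>E {g. g \<le> 0})"

fun kite_meet :: "'i set \<Rightarrow> 'j set \<Rightarrow> ('i, 'j, 'g::l_group) kite
    \<Rightarrow> ('i, 'j, 'g) kite \<Rightarrow> ('i, 'j, 'g) kite" where
  "kite_meet I J (Inl f) (Inl g) = Inl (\<lambda>j\<in>J. inf (f j) (g j))"
| "kite_meet I J (Inl f) (Inr y) = Inl f"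
| "kite_meet I J (Inr x) (Inl g) = Inl g"
| "kite_meet I J (Inr x) (Inr y) = Inr (\<lambda>i\<in>I. inf (x i) (y i))"

fun kite_join :: "'i set \<Rightarrow> 'j set \<Rightarrow> ('i, 'j, 'g::l_group) kite
    \<Rightarrow> ('i, 'j, 'g) kite \<Rightarrow> ('i, 'j, 'g) kite" where
  "kite_join I J (Inl f) (Inl g) = Inl (\<lambda>j\<in>J. sup (f j) (g j))"
| "kite_join I J (Inl f) (Inr y) = Inr y"
| "kite_join I J (Inr x) (Inl g) = Inr x"
| "kite_join I J (Inr x) (Inr y) = Inr (\<lambda>i\<in>I. sup (x i) (y i))"

text \<open>The product \<open>(b\<^sub>i a\<^sub>i)\<^sup>-\<^sup>1 = a\<^sub>i\<^sup>-\<^sup>1 b\<^sub>i\<^sup>-\<^sup>1\<close> becomes \<open>x i + y i\<close>.\<close>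

fun kite_mult :: "'i set \<Rightarrow> 'j set \<Rightarrow> ('j \<Rightarrow> 'i) \<Rightarrow> ('j \<Rightarrow> 'i) \<Rightarrow> ('i, 'j, 'g::l_group) kite
    \<Rightarrow> ('i, 'j, 'g) kite \<Rightarrow> ('i, 'j, 'g) kite" where
  "kite_mult I J l r (Inr x) (Inr y) = Inr (\<lambda>i\<in>I. x i + y i)"
| "kite_mult I J l r (Inr x) (Inl f) = Inl (\<lambda>j\<in>J. sup (x (l j) + f j) 0)"
| "kite_mult I J l r (Inl f) (Inr x) = Inl (\<lambda>j\<in>J. sup (f j + x (r j)) 0)"
| "kite_mult I J l r (Inl f) (Inl g) = Inl (\<lambda>j\<in>J. 0)"

fun kite_ldiv :: "'i set \<Rightarrow> 'j set \<Rightarrow> ('j \<Rightarrow> 'i) \<Rightarrow> ('j \<Rightarrow> 'i) \<Rightarrow> ('i, 'j, 'g::l_group) kite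
    \<Rightarrow> ('i, 'j, 'g) kite \<Rightarrow> ('i, 'j, 'g) kite" where
  "kite_ldiv I J l r (Inr x) (Inr y) = Inr (\<lambda>i\<in>I. inf (- x i + y i) 0)"
| "kite_ldiv I J l r (Inr x) (Inl f) = Inl (\<lambda>j\<in>J. - x (l j) + f j)"
| "kite_ldiv I J l r (Inl f) (Inl g) =
    Inr (\<lambda>i\<in>I. if i \<in> r ` J
      then inf (- f (inv_into J r i) + g (inv_into J r i)) 0 else 0)"
| "kite_ldiv I J l r (Inl f) (Inr x) = Inr (\<lambda>i\<in>I. 0)"

fun kite_rdiv :: "'i set \<Rightarrow> 'j set \<Rightarrow> ('j \<Rightarrow> 'i) \<Rightarrow> ('j \<Rightarrow> 'i) \<Rightarrow> ('i, 'j, 'g::l_group) kite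
    \<Rightarrow> ('i, 'j, 'g) kite \<Rightarrow> ('i, 'j, 'g) kite" where
  "kite_rdiv I J l r (Inr y) (Inr x) = Inr (\<lambda>i\<in>I. inf (y i - x i) 0)"
| "kite_rdiv I J l r (Inl f) (Inr x) = Inl (\<lambda>j\<in>J. f j - x (r j))"
| "kite_rdiv I J l r (Inl g) (Inl f) =
    Inr (\<lambda>i\<in>I. if i \<in> l ` J
      then inf (g (inv_into J l i) - f (inv_into J l i)) 0 else 0)"
| "kite_rdiv I J l r (Inr x) (Inl f) = Inr (\<lambda>i\<in>I. 0)"

definition kite :: "'i set \<Rightarrow> 'j set \<Rightarrow> ('j \<Rightarrow> 'i) \<Rightarrow> ('j \<Rightarrow> 'i)
    \<Rightarrow> ('i, 'j, 'g::l_group) kite fl" where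
  "kite I J l r = \<lparr>carrier = kite_carrier I J,
    monoid.mult = kite_mult I J l r, one = Inr (\<lambda>i\<in>I. 0),
    fl_meet = kite_meet I J, fl_join = kite_join I J,
    fl_ldiv = kite_ldiv I J l r, fl_rdiv = kite_rdiv I J l r,
    fl_zero = Inl (\<lambda>j\<in>J. 0)\<rparr>"

definition Z_dag :: "nat \<Rightarrow> (nat, nat, int) kite fl" where
  "Z_dag n = kite {1..n + 1} {1..n} (\<lambda>i. i) (\<lambda>i. i + 1)"

end

theory Submission imports Defs "HOL-Library.Countable_Set" begin

text \<open>
  In \<open>Z_dag n\<close> the two double negations \<open>(t \ 0) \ 0\<close> and \<open>0 / (0 / t)\<close> shift the coordinates over the
  negative cone by one place in either direction. Hence terms can isolate a coordinate and put a
  sequence together from its coordinates; the kite is generated by the sequence \<open>u\<close> with entries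
  \<open>0, \<dots>, 0, -1\<close>, and an identity failing in it fails at values that are terms in \<open>u\<close>. Scaling by \<open>m\<close>
  is an endomorphism, so from the failure at \<open>u\<close> one gets a term \<open>e\<close> with \<open>e(x) \<le> x\<close> for all
  \<open>x = (0, \<dots>, 0, -m)\<close> which is constantly \<open>1\<close> in every algebra satisfying the identity. If that
  algebra also satisfies the identities of \<open>Z_dag n\<close>, then all coordinates of \<open>y \<or> (y \ 0)\<close> are \<open>1\<close>,
  which is excluded middle, and the algebra is Boolean. This direct argument replaces Jonsson's
  lemma. Finally, \<open>n\<close> is recovered as the least number such that \<open>n + 1\<close> shifts annihilate every
  sequence over the negative cone.
\<close>

section \<open>Homomorphisms and identities\<close>

definition fl_hom :: "('a, 'b) fl_scheme \<Rightarrow> ('c, 'd) fl_scheme \<Rightarrow> ('a \<Rightarrow> 'c) \<Rightarrow> bool" where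
  "fl_hom A B h \<longleftrightarrow> h ` carrier A \<subseteq> carrier B \<and> h \<one>\<^bsub>A\<^esub> = \<one>\<^bsub>B\<^esub> \<and> h (fl_zero A) = fl_zero B \<and>
    (\<forall>x\<in>carrier A. \<forall>y\<in>carrier A.
      h (x \<otimes>\<^bsub>A\<^esub> y) = h x \<otimes>\<^bsub>B\<^esub> h y \<and>
      h (x \<^bold>\<and>\<^bsub>A\<^esub> y) = h x \<^bold>\<and>\<^bsub>B\<^esub> h y \<and> h (x \<^bold>\<or>\<^bsub>A\<^esub> y) = h x \<^bold>\<or>\<^bsub>B\<^esub> h y \<and>
      h (x \<setminus>\<^bsub>A\<^esub> y) = h x \<setminus>\<^bsub>B\<^esub> h y \<and> h (x \<^bold>/\<^bsub>A\<^esub> y) = h x \<^bold>/\<^bsub>B\<^esub> h y)"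

lemma fl_eval_closed:
  assumes "fl_structure A" "range v \<subseteq> carrier A"
  shows "fl_eval A v t \<in> carrier A"
proof -
  interpret fl_structure A by fact
  show ?thesis
    using assms(2) by (induction t) (auto intro: one_in zero_in mult_in meet_in join_in ldiv_in rdiv_in)
qed

lemma fl_eval_hom:
  assumes "fl_structure A" "fl_hom A B h" "range v \<subseteq> carrier A"
  shows "fl_eval B (\<lambda>k. h (v k)) t = h (fl_eval A v t)"
proof (induction t)
qed (use assms(2) fl_eval_closed[OF assms(1,3)] in \<open>simp_all add: fl_hom_def\<close>)

text \<open>Identities pass to subalgebras: \<open>B\<close> satisfies them at the images of the
  values, evaluation commutes with \<open>h\<close>, and injectivity pulls the equality
  back.\<close>

lemma satisfies_if_embeds:
  assumes "fl_structure A" "fl_hom A B h" "inj_on h (carrier A)" "satisfies B E"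
  shows "satisfies A E"
  unfolding satisfies_def
proof clarify
  fix s t and v :: "nat \<Rightarrow> 'a" assume st: "(s, t) \<in> E" and v: "range v \<subseteq> carrier A"
  have "range (\<lambda>k. h (v k)) \<subseteq> carrier B"
    using v assms(2) by (auto simp: fl_hom_def)
  then have "fl_eval B (\<lambda>k. h (v k)) s = fl_eval B (\<lambda>k. h (v k)) t"
    using assms(4) st by (auto simp: satisfies_def)
  then have "h (fl_eval A v s) = h (fl_eval A v t)"
    by (simp only: fl_eval_hom[OF assms(1,2) v])
  then show "fl_eval A v s = fl_eval A v t"
    using assms(3) fl_eval_closed[OF assms(1) v] by (simp add: inj_on_def)
qed

section \<open>Substitution and equational theories\<close>

primrec fl_subst :: "(nat \<Rightarrow> fl_term) \<Rightarrow> fl_term \<Rightarrow> fl_term" where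
  "fl_subst \<sigma> (Var k) = \<sigma> k"
| "fl_subst \<sigma> Zero = Zero"
| "fl_subst \<sigma> One = One"
| "fl_subst \<sigma> (Meet s t) = Meet (fl_subst \<sigma> s) (fl_subst \<sigma> t)"
| "fl_subst \<sigma> (Join s t) = Join (fl_subst \<sigma> s) (fl_subst \<sigma> t)"
| "fl_subst \<sigma> (Mult s t) = Mult (fl_subst \<sigma> s) (fl_subst \<sigma> t)"
| "fl_subst \<sigma> (Ldiv s t) = Ldiv (fl_subst \<sigma> s) (fl_subst \<sigma> t)"
| "fl_subst \<sigma> (Rdiv s t) = Rdiv (fl_subst \<sigma> s) (fl_subst \<sigma> t)"

lemma fl_eval_subst: "fl_eval A v (fl_subst \<sigma> t) = fl_eval A (\<lambda>k. fl_eval A v (\<sigma> k)) t"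
  by (induction t) auto

text \<open>Sets of pairs of terms do not mention the carrier type, so generators living on
  different types become comparable.\<close>

definition fl_theory :: "('a, 'b) fl_scheme \<Rightarrow> fl_identity set" where
  "fl_theory A = {(s, t). \<forall>v. range v \<subseteq> carrier A \<longrightarrow> fl_eval A v s = fl_eval A v t}"

lemma satisfies_iff_theory: "satisfies A E \<longleftrightarrow> E \<subseteq> fl_theory A"
  by (auto simp: satisfies_def fl_theory_def)

lemma variety_gen_iff:
  "A \<in> variety_gen B \<longleftrightarrow> fl_structure A \<and> fl_theory B \<subseteq> fl_theory A"
  by (auto simp: variety_gen_def Mod_def satisfies_iff_theory)

lemma variety_variety_gen: "variety (variety_gen B)"
proof -
  have "variety_gen B = Mod (fl_theory B)"
    by (auto simp: variety_gen_iff Mod_def satisfies_iff_theory)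
  then show ?thesis by (auto simp: variety_def)
qed

lemma theory_transfer:
  assumes "fl_theory B \<subseteq> fl_theory A" "range v \<subseteq> carrier A"
    and "\<And>w. range w \<subseteq> carrier B \<Longrightarrow> fl_eval B w s = fl_eval B w t"
  shows "fl_eval A v s = fl_eval A v t"
proof -
  have "(s, t) \<in> fl_theory B"
    using assms(3) by (simp add: fl_theory_def)
  then have "(s, t) \<in> fl_theory A"
    using assms(1) by blast
  then show ?thesis
    using assms(2) by (simp add: fl_theory_def)
qed

section \<open>Inclusion of generated varieties as reverse inclusion of theories\<close>

definition transport :: "('a \<Rightarrow> 'c) \<Rightarrow> ('a, 'b) fl_scheme \<Rightarrow> 'c fl" where
  "transport h A = (let k = inv_into (carrier A) h in
    \<lparr>carrier = h ` carrier A, monoid.mult = (\<lambda>x y. h (k x \<otimes>\<^bsub>A\<^esub> k y)), one = h \<one>\<^bsub>A\<^esub>,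
     fl_meet = (\<lambda>x y. h (k x \<^bold>\<and>\<^bsub>A\<^esub> k y)), fl_join = (\<lambda>x y. h (k x \<^bold>\<or>\<^bsub>A\<^esub> k y)),
     fl_ldiv = (\<lambda>x y. h (k x \<setminus>\<^bsub>A\<^esub> k y)), fl_rdiv = (\<lambda>x y. h (k x \<^bold>/\<^bsub>A\<^esub> k y)),
     fl_zero = h (fl_zero A)\<rparr>)"

text \<open>\<open>h\<close> and its inverse are both embeddings, so each theory contains the other.
  The copy serves to represent \<open>A\<close> on the type over which the generated varieties are
  formed.\<close>

lemma transport:
  assumes "fl_structure A" "inj_on h (carrier A)"
  shows "fl_structure (transport h A)" "fl_theory (transport h A) = fl_theory A"
proof -
  interpret fl_structure A by fact
  note closed = one_in zero_in mult_in meet_in join_in ldiv_in rdiv_in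
  let ?k = "inv_into (carrier A) h"
  show str: "fl_structure (transport h A)"
    by (unfold_locales) (auto simp: transport_def Let_def assms(2) closed)
  have h: "fl_hom A (transport h A) h"
    by (auto simp: fl_hom_def transport_def Let_def assms(2))
  have k: "fl_hom (transport h A) A ?k"
    by (auto simp: fl_hom_def transport_def Let_def assms(2) closed)
  have injk: "inj_on ?k (carrier (transport h A))"
    by (auto simp: transport_def Let_def intro: inj_on_inv_into)
  have "satisfies (transport h A) (fl_theory A)"
    using satisfies_if_embeds[OF str k injk] by (auto simp: satisfies_iff_theory)
  moreover have "satisfies A (fl_theory (transport h A))"
    using satisfies_if_embeds[OF assms(1) h assms(2)] by (auto simp: satisfies_iff_theory)
  ultimately show "fl_theory (transport h A) = fl_theory A"
    by (auto simp: satisfies_iff_theory)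
qed

text \<open>A countable \<open>A\<close> has a copy on any infinite type: number its carrier, then
  embed the naturals. The copy lies in \<open>variety_gen A\<close> and has the same theory as
  \<open>A\<close>, so membership in \<open>variety_gen B\<close> gives the inclusion of
  theories.\<close>

lemma variety_gen_le_iff:
  assumes "infinite (UNIV :: 'u set)" "fl_structure A" "countable (carrier A)"
  shows "(variety_gen A :: 'u fl set) \<subseteq> variety_gen B \<longleftrightarrow> fl_theory B \<subseteq> fl_theory A"
proof
  assume sub: "(variety_gen A :: 'u fl set) \<subseteq> variety_gen B"
  obtain f :: "nat \<Rightarrow> 'u" where f: "inj f"
    using assms(1) infinite_countable_subset by blast
  define h where "h = f \<circ> to_nat_on (carrier A)"
  have h: "inj_on h (carrier A)"
    unfolding h_def using f assms(3) by (meson comp_inj_on inj_on_subset inj_on_to_nat_on subset_UNIV)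
  have "transport h A \<in> variety_gen A"
    using transport[OF assms(2) h] by (simp add: variety_gen_iff)
  then show "fl_theory B \<subseteq> fl_theory A"
    using sub transport[OF assms(2) h] by (auto simp: variety_gen_iff subset_iff)
next
  assume "fl_theory B \<subseteq> fl_theory A"
  then show "(variety_gen A :: 'u fl set) \<subseteq> variety_gen B"
    by (meson order.trans subsetI variety_gen_iff)
qed


section \<open>Pseudo BL-algebras\<close>

context pseudo_BL_algebra
begin

section \<open>Order, bounds and residuation\<close>

lemmas ops_closed = one_in zero_in mult_in meet_in join_in ldiv_in rdiv_in

lemma meet_idem: "x \<in> carrier A \<Longrightarrow> x \<^bold>\<and> x = x"
  by (metis join_in join_absorb meet_absorb meet_in)

lemma le_refl: "x \<in> carrier A \<Longrightarrow> fl_le A x x"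
  by (simp add: fl_le_def meet_idem)

lemma le_antisym: "\<lbrakk>x \<in> carrier A; y \<in> carrier A; fl_le A x y; fl_le A y x\<rbrakk> \<Longrightarrow> x = y"
  by (metis fl_le_def meet_comm)

lemma le_trans:
  "\<lbrakk>x \<in> carrier A; y \<in> carrier A; z \<in> carrier A; fl_le A x y; fl_le A y z\<rbrakk> \<Longrightarrow> fl_le A x z"
  by (metis fl_le_def meet_assoc)

lemma meet_le1: "\<lbrakk>x \<in> carrier A; y \<in> carrier A\<rbrakk> \<Longrightarrow> fl_le A (x \<^bold>\<and> y) x"
  by (metis fl_le_def meet_assoc meet_comm meet_idem)

lemma meet_le2: "\<lbrakk>x \<in> carrier A; y \<in> carrier A\<rbrakk> \<Longrightarrow> fl_le A (x \<^bold>\<and> y) y"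
  by (metis meet_comm meet_le1)

lemma le_meet:
  "\<lbrakk>x \<in> carrier A; y \<in> carrier A; z \<in> carrier A; fl_le A z x; fl_le A z y\<rbrakk> \<Longrightarrow> fl_le A z (x \<^bold>\<and> y)"
  by (metis fl_le_def meet_assoc)

lemma join_le1: "\<lbrakk>x \<in> carrier A; y \<in> carrier A\<rbrakk> \<Longrightarrow> fl_le A x (x \<^bold>\<or> y)"
  by (simp add: fl_le_def meet_absorb)

lemma join_le2: "\<lbrakk>x \<in> carrier A; y \<in> carrier A\<rbrakk> \<Longrightarrow> fl_le A y (x \<^bold>\<or> y)"
  by (metis join_comm join_le1)

lemma le_iff_join: "\<lbrakk>x \<in> carrier A; y \<in> carrier A\<rbrakk> \<Longrightarrow> fl_le A x y \<longleftrightarrow> x \<^bold>\<or> y = y"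
  by (metis fl_le_def join_absorb join_comm meet_absorb meet_comm)

lemma join_least:
  "\<lbrakk>x \<in> carrier A; y \<in> carrier A; z \<in> carrier A; fl_le A x z; fl_le A y z\<rbrakk> \<Longrightarrow> fl_le A (x \<^bold>\<or> y) z"
  by (metis join_assoc join_in le_iff_join)

lemma meet_one: "x \<in> carrier A \<Longrightarrow> x \<^bold>\<and> \<one> = x"
  using le_one by (simp add: fl_le_def)

lemma one_meet: "x \<in> carrier A \<Longrightarrow> \<one> \<^bold>\<and> x = x"
  by (metis meet_comm meet_one one_in)

lemma zero_meet: "x \<in> carrier A \<Longrightarrow> fl_zero A \<^bold>\<and> x = fl_zero A"
  using zero_le by (simp add: fl_le_def)

lemma meet_zero: "x \<in> carrier A \<Longrightarrow> x \<^bold>\<and> fl_zero A = fl_zero A"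
  by (metis meet_comm zero_in zero_meet)

lemma zero_join: "x \<in> carrier A \<Longrightarrow> fl_zero A \<^bold>\<or> x = x"
  by (metis le_iff_join zero_in zero_le)

lemma join_zero: "x \<in> carrier A \<Longrightarrow> x \<^bold>\<or> fl_zero A = x"
  by (metis join_comm zero_in zero_join)

lemma join_one: "x \<in> carrier A \<Longrightarrow> x \<^bold>\<or> \<one> = \<one>"
  by (metis le_iff_join one_in le_one)

lemma one_join: "x \<in> carrier A \<Longrightarrow> \<one> \<^bold>\<or> x = \<one>"
  by (metis join_comm one_in join_one)

lemma one_leD: "\<lbrakk>x \<in> carrier A; fl_le A \<one> x\<rbrakk> \<Longrightarrow> x = \<one>"
  by (simp add: le_antisym le_one one_in)

lemma ldiv_eq_one_iff: "\<lbrakk>x \<in> carrier A; y \<in> carrier A\<rbrakk> \<Longrightarrow> x \<setminus> y = \<one> \<longleftrightarrow> fl_le A x y"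
  by (metis ldiv_in ldiv_residual le_refl one_in one_leD r_one)

lemma rdiv_eq_one_iff: "\<lbrakk>x \<in> carrier A; y \<in> carrier A\<rbrakk> \<Longrightarrow> y \<^bold>/ x = \<one> \<longleftrightarrow> fl_le A x y"
  by (metis rdiv_in rdiv_residual le_refl one_in one_leD l_one)

lemma one_ldiv: "x \<in> carrier A \<Longrightarrow> \<one> \<setminus> x = x"
  by (rule le_antisym)
    (metis l_one ldiv_in ldiv_residual le_refl one_in)+

lemma rdiv_one: "x \<in> carrier A \<Longrightarrow> x \<^bold>/ \<one> = x"
  by (rule le_antisym)
    (metis r_one rdiv_in rdiv_residual le_refl one_in)+

lemma meet_eq_one_iff:
  "\<lbrakk>x \<in> carrier A; y \<in> carrier A\<rbrakk> \<Longrightarrow> x \<^bold>\<and> y = \<one> \<longleftrightarrow> x = \<one> \<and> y = \<one>"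
  by (metis meet_idem meet_le1 meet_le2 one_leD one_in)

text \<open>Turns an equation into the statement that a single element is \<open>1\<close>;
  \<open>detecting_term\<close> uses it to replace an identity by one term.\<close>

lemma biresidual_eq_one_iff:
  "\<lbrakk>x \<in> carrier A; y \<in> carrier A\<rbrakk> \<Longrightarrow> (x \<setminus> y) \<^bold>\<and> (y \<setminus> x) = \<one> \<longleftrightarrow> x = y"
  by (metis meet_eq_one_iff ldiv_eq_one_iff ldiv_in le_antisym le_refl)

lemma mult_left_mono:
  assumes "x \<in> carrier A" "y \<in> carrier A" "z \<in> carrier A" "fl_le A y z"
  shows "fl_le A (x \<otimes> y) (x \<otimes> z)"
  by (metis assms ldiv_in ldiv_residual le_refl le_trans mult_in)

lemma mult_right_mono:
  assumes "x \<in> carrier A" "y \<in> carrier A" "z \<in> carrier A" "fl_le A y z"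
  shows "fl_le A (y \<otimes> x) (z \<otimes> x)"
  by (metis assms rdiv_in rdiv_residual le_refl le_trans mult_in)

lemma mult_le1: "\<lbrakk>x \<in> carrier A; y \<in> carrier A\<rbrakk> \<Longrightarrow> fl_le A (x \<otimes> y) x"
  by (metis le_one mult_left_mono one_in r_one)

lemma mult_le2: "\<lbrakk>x \<in> carrier A; y \<in> carrier A\<rbrakk> \<Longrightarrow> fl_le A (x \<otimes> y) y"
  by (metis le_one mult_right_mono one_in l_one)

text \<open>Left multiplication by \<open>x\<close> has a right adjoint, left division by
  \<open>x\<close>, and therefore preserves joins.\<close>

lemma mult_join_distrib:
  assumes "x \<in> carrier A" "y \<in> carrier A" "z \<in> carrier A"
  shows "x \<otimes> (y \<^bold>\<or> z) = (x \<otimes> y) \<^bold>\<or> (x \<otimes> z)"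
proof (rule le_antisym)
  have "fl_le A y (x \<setminus> ((x \<otimes> y) \<^bold>\<or> (x \<otimes> z)))" "fl_le A z (x \<setminus> ((x \<otimes> y) \<^bold>\<or> (x \<otimes> z)))"
    using assms by (simp_all add: ops_closed join_le1 join_le2 flip: ldiv_residual)
  then show "fl_le A (x \<otimes> (y \<^bold>\<or> z)) ((x \<otimes> y) \<^bold>\<or> (x \<otimes> z))"
    using assms by (simp add: ldiv_residual join_least ops_closed)
  show "fl_le A ((x \<otimes> y) \<^bold>\<or> (x \<otimes> z)) (x \<otimes> (y \<^bold>\<or> z))"
    using assms by (simp add: join_least mult_left_mono join_le1 join_le2 ops_closed)
qed (use assms in \<open>simp_all add: ops_closed\<close>)

end

text \<open>Apart from residuation the laws to be checked are identities, order being expressed by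
  meets. Residuation is an equivalence and is recovered from two inequalities for each
  division.\<close>

lemma pseudo_BL_if_theory:
  assumes "pseudo_BL_algebra B" "fl_structure A" "fl_theory B \<subseteq> fl_theory A"
  shows "pseudo_BL_algebra A"
proof -
  interpret B: pseudo_BL_algebra B by fact
  interpret fl_structure A by fact
  have ident: "fl_eval A (\<lambda>k. if k = 0 then x else if k = 1 then y else z) s =
      fl_eval A (\<lambda>k. if k = 0 then x else if k = 1 then y else z) t"
    if "x \<in> carrier A" "y \<in> carrier A" "z \<in> carrier A"
      and "\<And>w. range w \<subseteq> carrier B \<Longrightarrow> fl_eval B w s = fl_eval B w t" for x y z s t
    by (rule theory_transfer[OF assms(3)]) (use that in auto)
  let ?x = "Var 0" and ?y = "Var 1" and ?z = "Var 2"
  note B_closed = B.ops_closed range_subsetD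
  \<comment> \<open>If \<open>y \<le> x \<setminus> z\<close>, the inner meet is \<open>y\<close>
    and this reads \<open>x y \<le> z\<close>. If \<open>x y \<le> z\<close>, the join in
    \<open>ldiv2\<close> is \<open>z\<close> and that fact reads
    \<open>y \<le> x \<setminus> z\<close>. The pair for \<open>/\<close> is analogous.\<close>
  have ldiv1: "fl_le A (x \<otimes>\<^bsub>A\<^esub> ((x \<setminus>\<^bsub>A\<^esub> z) \<^bold>\<and>\<^bsub>A\<^esub> y)) z"
    if "x \<in> carrier A" "y \<in> carrier A" "z \<in> carrier A" for x y z
    using ident[OF that, of "Meet (Mult ?x (Meet (Ldiv ?x ?z) ?y)) ?z" "Mult ?x (Meet (Ldiv ?x ?z) ?y)"]
    by (simp add: B_closed B.meet_le1 B.ldiv_residual flip: fl_le_def)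
  have ldiv2: "fl_le A y (x \<setminus>\<^bsub>A\<^esub> ((x \<otimes>\<^bsub>A\<^esub> y) \<^bold>\<or>\<^bsub>A\<^esub> z))"
    if "x \<in> carrier A" "y \<in> carrier A" "z \<in> carrier A" for x y z
    using ident[OF that, of "Meet ?y (Ldiv ?x (Join (Mult ?x ?y) ?z))" "?y"]
    by (simp add: B_closed B.join_le1 flip: fl_le_def B.ldiv_residual)
  have rdiv1: "fl_le A (((z \<^bold>/\<^bsub>A\<^esub> y) \<^bold>\<and>\<^bsub>A\<^esub> x) \<otimes>\<^bsub>A\<^esub> y) z"
    if "x \<in> carrier A" "y \<in> carrier A" "z \<in> carrier A" for x y z
    using ident[OF that, of "Meet (Mult (Meet (Rdiv ?z ?y) ?x) ?y) ?z" "Mult (Meet (Rdiv ?z ?y) ?x) ?y"]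
    by (simp add: B_closed B.meet_le1 B.rdiv_residual flip: fl_le_def)
  have rdiv2: "fl_le A x (((x \<otimes>\<^bsub>A\<^esub> y) \<^bold>\<or>\<^bsub>A\<^esub> z) \<^bold>/\<^bsub>A\<^esub> y)"
    if "x \<in> carrier A" "y \<in> carrier A" "z \<in> carrier A" for x y z
    using ident[OF that, of "Meet ?x (Rdiv (Join (Mult ?x ?y) ?z) ?y)" "?x"]
    by (simp add: B_closed B.join_le1 flip: fl_le_def B.rdiv_residual)
  have mcomm: "x \<^bold>\<and>\<^bsub>A\<^esub> y = y \<^bold>\<and>\<^bsub>A\<^esub> x" if "x \<in> carrier A" "y \<in> carrier A" for x y
    using ident[OF that that(2), of "Meet ?x ?y" "Meet ?y ?x"] by (simp add: B_closed B.meet_comm)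
  have jcomm: "x \<^bold>\<or>\<^bsub>A\<^esub> y = y \<^bold>\<or>\<^bsub>A\<^esub> x" if "x \<in> carrier A" "y \<in> carrier A" for x y
    using ident[OF that that(2), of "Join ?x ?y" "Join ?y ?x"] by (simp add: B_closed B.join_comm)
  have mabs: "x \<^bold>\<and>\<^bsub>A\<^esub> (x \<^bold>\<or>\<^bsub>A\<^esub> y) = x" if "x \<in> carrier A" "y \<in> carrier A" for x y
    using ident[OF that that(2), of "Meet ?x (Join ?x ?y)" "?x"] by (simp add: B_closed B.meet_absorb)
  have jabs: "x \<^bold>\<or>\<^bsub>A\<^esub> (x \<^bold>\<and>\<^bsub>A\<^esub> y) = x" if "x \<in> carrier A" "y \<in> carrier A" for x y
    using ident[OF that that(2), of "Join ?x (Meet ?x ?y)" "?x"] by (simp add: B_closed B.join_absorb)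
  have join_eq: "x \<^bold>\<or>\<^bsub>A\<^esub> z = z" if "x \<in> carrier A" "z \<in> carrier A" "fl_le A x z" for x z
    by (metis fl_le_def jabs jcomm mcomm that)
  show ?thesis
  proof unfold_locales
    fix x y z assume c: "x \<in> carrier A" "y \<in> carrier A" "z \<in> carrier A"
    show "x \<otimes>\<^bsub>A\<^esub> y \<otimes>\<^bsub>A\<^esub> z = x \<otimes>\<^bsub>A\<^esub> (y \<otimes>\<^bsub>A\<^esub> z)"
      using ident[OF c, of "Mult (Mult ?x ?y) ?z" "Mult ?x (Mult ?y ?z)"]
      by (simp add: B_closed B.m_assoc)
    show "(x \<^bold>\<and>\<^bsub>A\<^esub> y) \<^bold>\<and>\<^bsub>A\<^esub> z = x \<^bold>\<and>\<^bsub>A\<^esub> (y \<^bold>\<and>\<^bsub>A\<^esub> z)"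
      using ident[OF c, of "Meet (Meet ?x ?y) ?z" "Meet ?x (Meet ?y ?z)"]
      by (simp add: B_closed B.meet_assoc)
    show "(x \<^bold>\<or>\<^bsub>A\<^esub> y) \<^bold>\<or>\<^bsub>A\<^esub> z = x \<^bold>\<or>\<^bsub>A\<^esub> (y \<^bold>\<or>\<^bsub>A\<^esub> z)"
      using ident[OF c, of "Join (Join ?x ?y) ?z" "Join ?x (Join ?y ?z)"]
      by (simp add: B_closed B.join_assoc)
    show "fl_le A (x \<otimes>\<^bsub>A\<^esub> y) z \<longleftrightarrow> fl_le A y (x \<setminus>\<^bsub>A\<^esub> z)"
      using ldiv1[OF c] ldiv2[OF c] join_eq[of "x \<otimes>\<^bsub>A\<^esub> y" z] c
      by (metis fl_le_def ldiv_in mcomm mult_in)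
    show "fl_le A (x \<otimes>\<^bsub>A\<^esub> y) z \<longleftrightarrow> fl_le A x (z \<^bold>/\<^bsub>A\<^esub> y)"
      using rdiv1[OF c] rdiv2[OF c] join_eq[of "x \<otimes>\<^bsub>A\<^esub> y" z] c
      by (metis fl_le_def rdiv_in mcomm mult_in)
  next
    fix x y assume c: "x \<in> carrier A" "y \<in> carrier A"
    show "x \<otimes>\<^bsub>A\<^esub> (x \<setminus>\<^bsub>A\<^esub> (x \<^bold>\<and>\<^bsub>A\<^esub> y)) = x \<^bold>\<and>\<^bsub>A\<^esub> y"
      using ident[OF c c(2), of "Mult ?x (Ldiv ?x (Meet ?x ?y))" "Meet ?x ?y"]
      by (simp add: B_closed B.ldiv_divisible)
    show "((x \<^bold>\<and>\<^bsub>A\<^esub> y) \<^bold>/\<^bsub>A\<^esub> x) \<otimes>\<^bsub>A\<^esub> x = x \<^bold>\<and>\<^bsub>A\<^esub> y"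
      using ident[OF c c(2), of "Mult (Rdiv (Meet ?x ?y) ?x) ?x" "Meet ?x ?y"]
      by (simp add: B_closed B.rdiv_divisible)
    show "(x \<setminus>\<^bsub>A\<^esub> y) \<^bold>\<or>\<^bsub>A\<^esub> (y \<setminus>\<^bsub>A\<^esub> x) = \<one>\<^bsub>A\<^esub>"
      using ident[OF c c(2), of "Join (Ldiv ?x ?y) (Ldiv ?y ?x)" "One"]
      by (simp add: B_closed B.ldiv_prelinear)
    show "(y \<^bold>/\<^bsub>A\<^esub> x) \<^bold>\<or>\<^bsub>A\<^esub> (x \<^bold>/\<^bsub>A\<^esub> y) = \<one>\<^bsub>A\<^esub>"
      using ident[OF c c(2), of "Join (Rdiv ?y ?x) (Rdiv ?x ?y)" "One"]
      by (simp add: B_closed B.rdiv_prelinear)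
  next
    fix x assume c: "x \<in> carrier A"
    show "\<one>\<^bsub>A\<^esub> \<otimes>\<^bsub>A\<^esub> x = x" "x \<otimes>\<^bsub>A\<^esub> \<one>\<^bsub>A\<^esub> = x"
      using ident[OF c c c, of "Mult One ?x" "?x"] ident[OF c c c, of "Mult ?x One" "?x"]
      by (simp_all add: B_closed)
    show "fl_le A (fl_zero A) x" "fl_le A x \<one>\<^bsub>A\<^esub>"
      using ident[OF c c c, of "Meet Zero ?x" "Zero"] ident[OF c c c, of "Meet ?x One" "?x"]
        B.zero_le B.le_one
      by (simp_all add: B_closed fl_le_def)
  qed (simp_all add: one_in zero_in mult_in meet_in join_in ldiv_in rdiv_in mcomm jcomm mabs jabs)
qed

lemma pseudo_BL_variety_gen:
  assumes "pseudo_BL_algebra B"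
  shows "pseudo_BL_variety (variety_gen B)"
  using pseudo_BL_if_theory[OF assms] by (auto simp: pseudo_BL_variety_def variety_variety_gen variety_gen_iff)

lemma pseudo_BL_two: "pseudo_BL_algebra two"
  by unfold_locales (auto simp: two_def fl_le_def)


section \<open>Boolean algebras\<close>

text \<open>A strict bound on the variable indices of a term; Shannon expansion then has only
  finitely many variables to treat.\<close>

primrec var_bound :: "fl_term \<Rightarrow> nat" where
  "var_bound (Var k) = Suc k"
| "var_bound Zero = 0"
| "var_bound One = 0"
| "var_bound (Meet s t) = max (var_bound s) (var_bound t)"
| "var_bound (Join s t) = max (var_bound s) (var_bound t)"
| "var_bound (Mult s t) = max (var_bound s) (var_bound t)"
| "var_bound (Ldiv s t) = max (var_bound s) (var_bound t)"
| "var_bound (Rdiv s t) = max (var_bound s) (var_bound t)"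

lemma fl_eval_cong_vars:
  "(\<And>k. k < var_bound t \<Longrightarrow> v k = w k) \<Longrightarrow> fl_eval A v t = fl_eval A w t"
  by (induction t) auto

text \<open>
  Under the law of excluded middle, \<open>a \<mapsto> p \<^bold>\<and> a\<close> has a congruence as its kernel, so that a term may be
  evaluated by Shannon expansion: below \<open>p = v k\<close> one may replace \<open>v k\<close> by \<open>1\<close>, and below its
  complement by \<open>0\<close>.
\<close>

lemma (in pseudo_BL_algebra) theory_two_if_excluded_middle:
  assumes em: "\<And>x. x \<in> carrier A \<Longrightarrow> x \<^bold>\<or> (x \<setminus> fl_zero A) = \<one>"
  shows "fl_theory two \<subseteq> fl_theory A"
proof -
  have str: "fl_structure A" by unfold_locales
  let ?c = "\<lambda>x. x \<setminus> fl_zero A"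
  \<comment> \<open>\<open>x = x (x \<or> (x \<setminus> 0)) = x x \<or> 0 = x x\<close>.\<close>
  have idem: "x \<otimes> x = x" if "x \<in> carrier A" for x
  proof -
    have "x \<otimes> ?c x = fl_zero A"
      using that by (intro le_antisym zero_le) (simp_all add: ops_closed ldiv_residual le_refl)
    then have "x \<otimes> (x \<^bold>\<or> ?c x) = x \<otimes> x"
      using that by (simp add: mult_join_distrib ops_closed join_zero)
    then show ?thesis
      using that by (simp add: em)
  qed
  \<comment> \<open>A product is below both factors; conversely \<open>x \<and> y\<close> is its own
    square, which is below \<open>x y\<close>.\<close>
  have mult_eq: "x \<otimes> y = x \<^bold>\<and> y" if "x \<in> carrier A" "y \<in> carrier A" for x y
  proof (rule le_antisym)
    have "fl_le A ((x \<^bold>\<and> y) \<otimes> (x \<^bold>\<and> y)) (x \<otimes> y)"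
      by (rule le_trans[of _ "x \<otimes> (x \<^bold>\<and> y)"])
        (use that in \<open>simp_all add: ops_closed mult_left_mono mult_right_mono meet_le1 meet_le2\<close>)
    then show "fl_le A (x \<^bold>\<and> y) (x \<otimes> y)"
      using that by (simp add: idem meet_in)
  qed (use that in \<open>simp_all add: ops_closed le_meet mult_le1 mult_le2\<close>)
  have rdiv_eq: "y \<^bold>/ x = x \<setminus> y" if "x \<in> carrier A" "y \<in> carrier A" for x y
  proof (rule le_antisym)
    have comm: "x \<otimes> z = z \<otimes> x" if "z \<in> carrier A" for z
      using that \<open>x \<in> carrier A\<close> by (simp add: mult_eq meet_comm)
    show "fl_le A (y \<^bold>/ x) (x \<setminus> y)"
      using that comm[of "y \<^bold>/ x"] ldiv_residual[of x "y \<^bold>/ x" y] rdiv_residual[of "y \<^bold>/ x" x y]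
      by (simp add: rdiv_in le_refl)
    show "fl_le A (x \<setminus> y) (y \<^bold>/ x)"
      using that comm[of "x \<setminus> y"] ldiv_residual[of x "x \<setminus> y" y] rdiv_residual[of "x \<setminus> y" x y]
      by (simp add: ldiv_in le_refl)
  qed (use that in \<open>simp_all add: ops_closed\<close>)
  have distrib: "p \<^bold>\<and> (a \<^bold>\<or> b) = (p \<^bold>\<and> a) \<^bold>\<or> (p \<^bold>\<and> b)"
    if "p \<in> carrier A" "a \<in> carrier A" "b \<in> carrier A" for p a b
    using mult_join_distrib[OF that] that by (simp add: mult_eq ops_closed)
  have meet_cong: "p \<^bold>\<and> (a \<^bold>\<and> b) = p \<^bold>\<and> (a' \<^bold>\<and> b')"
    if "p \<in> carrier A" "a \<in> carrier A" "b \<in> carrier A" "a' \<in> carrier A" "b' \<in> carrier A"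
      "p \<^bold>\<and> a = p \<^bold>\<and> a'" "p \<^bold>\<and> b = p \<^bold>\<and> b'" for p a b a' b'
  proof -
    have *: "p \<^bold>\<and> (c \<^bold>\<and> d) = (p \<^bold>\<and> c) \<^bold>\<and> (p \<^bold>\<and> d)" if "c \<in> carrier A" "d \<in> carrier A" for c d
      using that \<open>p \<in> carrier A\<close> by (intro le_antisym le_meet)
        (meson le_trans meet_in meet_le1 meet_le2)+
    show ?thesis
      using that by (simp add: *)
  qed
  \<comment> \<open>Below \<open>p\<close>, \<open>a\<close> and \<open>a'\<close> agree, so
    \<open>a' \<and> p \<and> (a \<setminus> b)\<close> is below
    \<open>p \<and> b = p \<and> b'\<close>; residuation moves \<open>a'\<close> to the other
    side.\<close>
  have ldiv_le: "fl_le A (p \<^bold>\<and> (a \<setminus> b)) (p \<^bold>\<and> (a' \<setminus> b'))"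
    if c: "p \<in> carrier A" "a \<in> carrier A" "b \<in> carrier A" "a' \<in> carrier A" "b' \<in> carrier A"
      and eq: "p \<^bold>\<and> a = p \<^bold>\<and> a'" "p \<^bold>\<and> b = p \<^bold>\<and> b'" for p a b a' b'
  proof (rule le_meet)
    have "a' \<^bold>\<and> (p \<^bold>\<and> (a \<setminus> b)) = p \<^bold>\<and> (a \<^bold>\<and> (a \<setminus> b))"
      using c eq by (metis ldiv_in meet_assoc meet_comm)
    also have "fl_le A \<dots> (p \<^bold>\<and> b)"
    proof (rule le_meet)
      have "fl_le A (a \<^bold>\<and> (a \<setminus> b)) b"
        using c by (simp add: ldiv_in ldiv_residual le_refl flip: mult_eq)
      then show "fl_le A (p \<^bold>\<and> (a \<^bold>\<and> (a \<setminus> b))) b"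
        using c by (rule_tac le_trans[of _ "a \<^bold>\<and> (a \<setminus> b)" b]) (simp_all add: ops_closed meet_le2)
    qed (use c in \<open>simp_all add: ops_closed meet_le1\<close>)
    finally have "fl_le A (a' \<^bold>\<and> (p \<^bold>\<and> (a \<setminus> b))) b'"
      unfolding eq(2) using c
      by (rule_tac le_trans[of _ "p \<^bold>\<and> b'" b']) (simp_all add: ops_closed meet_le2)
    then show "fl_le A (p \<^bold>\<and> (a \<setminus> b)) (a' \<setminus> b')"
      using c by (simp add: ops_closed mult_eq flip: ldiv_residual)
  qed (use c in \<open>simp_all add: ops_closed meet_le1\<close>)
  have ldiv_cong: "p \<^bold>\<and> (a \<setminus> b) = p \<^bold>\<and> (a' \<setminus> b')"
    if "p \<in> carrier A" "a \<in> carrier A" "b \<in> carrier A" "a' \<in> carrier A" "b' \<in> carrier A"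
      "p \<^bold>\<and> a = p \<^bold>\<and> a'" "p \<^bold>\<and> b = p \<^bold>\<and> b'" for p a b a' b'
    using ldiv_le[of p a b a' b'] ldiv_le[of p a' b' a b] that
    by (metis ldiv_in le_antisym meet_in)
  have eval_cong: "p \<^bold>\<and> fl_eval A v t = p \<^bold>\<and> fl_eval A w t"
    if p: "p \<in> carrier A" and v: "range v \<subseteq> carrier A" and w: "range w \<subseteq> carrier A"
      and eq: "\<And>k. p \<^bold>\<and> v k = p \<^bold>\<and> w k" for p v w t
  proof (induction t)
    case (Meet s t)
    then show ?case
      using meet_cong[OF p] fl_eval_closed[OF str v] fl_eval_closed[OF str w] by simp
  next
    case (Mult s t)
    then show ?case
      using meet_cong[OF p] fl_eval_closed[OF str v] fl_eval_closed[OF str w] by (simp add: mult_eq)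
  next
    case (Ldiv s t)
    then show ?case
      using ldiv_cong[OF p] fl_eval_closed[OF str v] fl_eval_closed[OF str w] by simp
  next
    case (Rdiv s t)
    then show ?case
      using ldiv_cong[OF p] fl_eval_closed[OF str v] fl_eval_closed[OF str w] by (simp add: rdiv_eq)
  qed (simp_all add: p eq distrib fl_eval_closed[OF str v] fl_eval_closed[OF str w])
  let ?h = "\<lambda>b. if b then \<one> else fl_zero A"
  \<comment> \<open>The bounds of \<open>A\<close> are closed under the operations and compute as in
    \<open>two\<close>. The map need not be injective, as \<open>A\<close> may be trivial.\<close>
  have hom: "fl_hom two A ?h"
    by (auto simp: fl_hom_def two_def ops_closed one_ldiv rdiv_one meet_idem
        ldiv_eq_one_iff[THEN iffD2] rdiv_eq_one_iff[THEN iffD2] zero_le le_one le_refl mult_eq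
        meet_one one_meet zero_meet meet_zero zero_join join_zero join_one one_join)
  show ?thesis
  proof (clarsimp simp: fl_theory_def[of A])
    fix s t and v :: "nat \<Rightarrow> 'a"
    assume st: "(s, t) \<in> fl_theory two" and v: "range v \<subseteq> carrier A"
    \<comment> \<open>Induction on a finite set \<open>K\<close> outside which all values are
      \<open>0\<close> or \<open>1\<close>; each step removes one variable by expansion.\<close>
    have eq: "fl_eval A w s = fl_eval A w t"
      if "finite K" "range w \<subseteq> carrier A" "\<And>k. k \<notin> K \<Longrightarrow> w k \<in> {fl_zero A, \<one>}" for K w
      using that
    proof (induction K arbitrary: w)
      case empty
      have str2: "fl_structure two"
        by unfold_locales (auto simp: two_def)
      define b where "b k \<longleftrightarrow> w k = \<one>" for k
      have "w = (\<lambda>k. ?h (b k))"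
        by (rule ext) (use empty in \<open>auto simp: b_def\<close>)
      then have "fl_eval A w r = ?h (fl_eval two b r)" for r
        using fl_eval_hom[OF str2 hom, of b r] by (simp add: two_def)
      moreover have "fl_eval two b s = fl_eval two b t"
        using st by (simp add: fl_theory_def two_def)
      ultimately show ?case by simp
    next
      case (insert k K)
      let ?p = "w k"
      have p: "?p \<in> carrier A"
        using insert.prems(1) by auto
      then have q: "?c ?p \<in> carrier A"
        by (simp add: ops_closed)
      have pq: "?c ?p \<^bold>\<and> ?p = ?c ?p \<^bold>\<and> fl_zero A"
      proof -
        have "?p \<^bold>\<and> ?c ?p = fl_zero A"
          using p q by (intro le_antisym zero_le)
            (simp_all add: ops_closed ldiv_residual le_refl flip: mult_eq)
        then show ?thesis
          using p q by (metis meet_comm meet_zero)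
      qed
      have c1: "range (w(k := a)) \<subseteq> carrier A" if "a \<in> carrier A" for a
        using insert.prems(1) that by auto
      have c2: "fl_eval A (w(k := a)) s = fl_eval A (w(k := a)) t" if "a \<in> {fl_zero A, \<one>}" for a
        using insert.prems that by (intro insert.IH) (auto simp: ops_closed)
      have *: "p \<^bold>\<and> fl_eval A w s = p \<^bold>\<and> fl_eval A w t"
        if "p \<in> carrier A" "a \<in> {fl_zero A, \<one>}" "p \<^bold>\<and> w k = p \<^bold>\<and> a" for p a
      proof -
        have "a \<in> carrier A" using that(2) by (auto simp: ops_closed)
        have "p \<^bold>\<and> fl_eval A w r = p \<^bold>\<and> fl_eval A (w(k := a)) r" for r
          by (rule eval_cong[OF that(1) insert.prems(1) c1[OF \<open>a \<in> carrier A\<close>]]) (use that in auto)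
        then show ?thesis using c2[OF that(2)] by simp
      qed
      have "?p \<^bold>\<and> ?p = ?p \<^bold>\<and> \<one>"
        using p by (simp add: meet_idem meet_one)
      then have 1: "?p \<^bold>\<and> fl_eval A w s = ?p \<^bold>\<and> fl_eval A w t"
        using *[OF p] by blast
      have 2: "?c ?p \<^bold>\<and> fl_eval A w s = ?c ?p \<^bold>\<and> fl_eval A w t"
        using *[OF q _ pq] by blast
      have split: "a = (?p \<^bold>\<and> a) \<^bold>\<or> (?c ?p \<^bold>\<and> a)" if "a \<in> carrier A" for a
        using distrib[OF that p q] em[OF p] that p q
        by (metis meet_comm meet_one)
      show ?case
        using split[of "fl_eval A w s"] split[of "fl_eval A w t"] 1 2
          fl_eval_closed[OF str insert.prems(1)] by simp
    qed
    let ?N = "max (var_bound s) (var_bound t)"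
    \<comment> \<open>Variables beyond those of \<open>s\<close> and \<open>t\<close> are set to
      \<open>1\<close>, which makes the set of arbitrary values finite.\<close>
    let ?v = "\<lambda>k. if k < ?N then v k else \<one>"
    have "fl_eval A ?v s = fl_eval A ?v t"
      by (rule eq[of "{..<?N}"]) (use v in \<open>auto simp: ops_closed\<close>)
    moreover have "fl_eval A ?v s = fl_eval A v s" "fl_eval A ?v t = fl_eval A v t"
      by (rule fl_eval_cong_vars; simp add: less_max_iff_disj)+
    ultimately show "fl_eval A v s = fl_eval A v t" by simp
  qed
qed


section \<open>The kites \<open>Z_dag n\<close>\<close>

text \<open>\<open>neg\<close> and \<open>pos\<close> restrict arbitrary functions to the index
  sets, so that the operations can be written as plain coordinate formulas without extensionality
  conditions.\<close>

definition neg :: "nat \<Rightarrow> (nat \<Rightarrow> int) \<Rightarrow> (nat, nat, int) kite" where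
  "neg n x = Inr (restrict x {1..n + 1})"

definition pos :: "nat \<Rightarrow> (nat \<Rightarrow> int) \<Rightarrow> (nat, nat, int) kite" where
  "pos n f = Inl (restrict f {1..n})"

lemma neg_eq_iff: "neg n x = neg n y \<longleftrightarrow> (\<forall>i\<in>{1..n + 1}. x i = y i)"
  by (auto simp: neg_def restrict_def fun_eq_iff)

lemma pos_eq_iff: "pos n f = pos n g \<longleftrightarrow> (\<forall>j\<in>{1..n}. f j = g j)"
  by (auto simp: pos_def restrict_def fun_eq_iff)

lemma neg_neq_pos [simp]: "neg n x \<noteq> pos n f" "pos n f \<noteq> neg n x"
  by (simp_all add: neg_def pos_def)

text \<open>Extending the sequences by \<open>0\<close> gives representatives with the right sign at
  every index, also outside the index sets.\<close>

lemma Z_dag_cases [consumes 1, case_names neg pos]: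
  assumes "u \<in> carrier (Z_dag n)"
  obtains x where "u = neg n x" "\<And>i. x i \<le> 0"
    | f where "u = pos n f" "\<And>j. 0 \<le> f j"
proof (cases u)
  case (Inr y)
  define x where "x i = (if i \<in> {1..n + 1} then y i else 0)" for i
  have "u = neg n x" "x i \<le> 0" for i
    using assms
    by (auto simp: Inr x_def Z_dag_def kite_def kite_carrier_def neg_def PiE_iff extensional_def
        restrict_def fun_eq_iff)
  then show ?thesis using that by blast
next
  case (Inl y)
  define f where "f i = (if i \<in> {1..n} then y i else 0)" for i
  have "u = pos n f" "0 \<le> f i" for i
    using assms
    by (auto simp: Inl f_def Z_dag_def kite_def kite_carrier_def pos_def PiE_iff extensional_def
        restrict_def fun_eq_iff)
  then show ?thesis using that by blast
qed

lemma neg_in_Z_dag: "neg n x \<in> carrier (Z_dag n) \<longleftrightarrow> (\<forall>i\<in>{1..n + 1}. x i \<le> 0)"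
  and pos_in_Z_dag: "pos n f \<in> carrier (Z_dag n) \<longleftrightarrow> (\<forall>j\<in>{1..n}. 0 \<le> f j)"
  by (auto simp: Z_dag_def kite_def kite_carrier_def neg_def pos_def PiE_iff)

text \<open>Here \<open>\<lambda>\<close> is the identity and \<open>\<rho>\<close> the successor,
  so their images are the indices \<open>\<le> n\<close> and \<open>\<ge> 2\<close>, and their
  inverses are \<open>i\<close> and \<open>i - 1\<close>. This accounts for the conditions in the
  two quotients of \<open>pos\<close> by \<open>pos\<close>.\<close>

lemma Z_dag_ops:
  "\<one>\<^bsub>Z_dag n\<^esub> = neg n (\<lambda>i. 0)"
  "fl_zero (Z_dag n) = pos n (\<lambda>j. 0)"
  "neg n x \<otimes>\<^bsub>Z_dag n\<^esub> neg n y = neg n (\<lambda>i. x i + y i)"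
  "neg n x \<otimes>\<^bsub>Z_dag n\<^esub> pos n f = pos n (\<lambda>j. max (x j + f j) 0)"
  "pos n f \<otimes>\<^bsub>Z_dag n\<^esub> neg n x = pos n (\<lambda>j. max (f j + x (j + 1)) 0)"
  "pos n f \<otimes>\<^bsub>Z_dag n\<^esub> pos n g = pos n (\<lambda>j. 0)"
  "neg n x \<^bold>\<and>\<^bsub>Z_dag n\<^esub> neg n y = neg n (\<lambda>i. min (x i) (y i))"
  "neg n x \<^bold>\<and>\<^bsub>Z_dag n\<^esub> pos n f = pos n f"
  "pos n f \<^bold>\<and>\<^bsub>Z_dag n\<^esub> neg n x = pos n f"
  "pos n f \<^bold>\<and>\<^bsub>Z_dag n\<^esub> pos n g = pos n (\<lambda>j. min (f j) (g j))"
  "neg n x \<^bold>\<or>\<^bsub>Z_dag n\<^esub> neg n y = neg n (\<lambda>i. max (x i) (y i))"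
  "neg n x \<^bold>\<or>\<^bsub>Z_dag n\<^esub> pos n f = neg n x"
  "pos n f \<^bold>\<or>\<^bsub>Z_dag n\<^esub> neg n x = neg n x"
  "pos n f \<^bold>\<or>\<^bsub>Z_dag n\<^esub> pos n g = pos n (\<lambda>j. max (f j) (g j))"
  "neg n x \<setminus>\<^bsub>Z_dag n\<^esub> neg n y = neg n (\<lambda>i. min (y i - x i) 0)"
  "neg n x \<setminus>\<^bsub>Z_dag n\<^esub> pos n f = pos n (\<lambda>j. f j - x j)"
  "pos n f \<setminus>\<^bsub>Z_dag n\<^esub> neg n x = neg n (\<lambda>i. 0)"
  "pos n f \<setminus>\<^bsub>Z_dag n\<^esub> pos n g = neg n (\<lambda>i. if 2 \<le> i then min (g (i - 1) - f (i - 1)) 0 else 0)"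
  "neg n y \<^bold>/\<^bsub>Z_dag n\<^esub> neg n x = neg n (\<lambda>i. min (y i - x i) 0)"
  "pos n f \<^bold>/\<^bsub>Z_dag n\<^esub> neg n x = pos n (\<lambda>j. f j - x (j + 1))"
  "neg n x \<^bold>/\<^bsub>Z_dag n\<^esub> pos n f = neg n (\<lambda>i. 0)"
  "pos n g \<^bold>/\<^bsub>Z_dag n\<^esub> pos n f = neg n (\<lambda>i. if i \<le> n then min (g i - f i) 0 else 0)"
proof -
  have *: "i \<in> Suc ` {1..n} \<longleftrightarrow> 2 \<le> i" if "i \<in> {1..n + 1}" for i
    using that by (auto simp: image_Suc_atLeastAtMost)
  have "inv_into {1..n} Suc i = i - 1" if "2 \<le> i" "i \<le> Suc n" for i
    using that by (intro inv_into_f_eq) auto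
  then show
    "pos n f \<setminus>\<^bsub>Z_dag n\<^esub> pos n g = neg n (\<lambda>i. if 2 \<le> i then min (g (i - 1) - f (i - 1)) 0 else 0)"
    using * by (auto simp: Z_dag_def kite_def neg_def pos_def fun_eq_iff restrict_def inf_min)
  have "inv_into {1..n} (\<lambda>i. i) i = i" if "i \<in> {1..n}" for i
    using that by (intro inv_into_f_eq) auto
  then show "pos n g \<^bold>/\<^bsub>Z_dag n\<^esub> pos n f = neg n (\<lambda>i. if i \<le> n then min (g i - f i) 0 else 0)"
    by (auto simp: Z_dag_def kite_def neg_def pos_def fun_eq_iff restrict_def inf_min)
qed (auto simp: Z_dag_def kite_def neg_def pos_def restrict_def fun_eq_iff inf_min sup_max)

lemmas Z_dag_simps = Z_dag_ops neg_eq_iff pos_eq_iff neg_in_Z_dag pos_in_Z_dag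

lemma Z_dag_le:
  "fl_le (Z_dag n) (neg n x) (neg n y) \<longleftrightarrow> (\<forall>i\<in>{1..n + 1}. x i \<le> y i)"
  "fl_le (Z_dag n) (pos n f) (neg n y)"
  "\<not> fl_le (Z_dag n) (neg n x) (pos n g)"
  "fl_le (Z_dag n) (pos n f) (pos n g) \<longleftrightarrow> (\<forall>j\<in>{1..n}. f j \<le> g j)"
  by (auto simp: fl_le_def Z_dag_simps min_def)

text \<open>For \<open>g \<ge> 0\<close> the right-hand side says that \<open>pos n f\<close> times
  \<open>neg n x\<close> is below \<open>pos n g\<close>: this is residuation in the case where the
  index is shifted. Coordinate 1 of the quotient is \<open>0\<close> and imposes no
  condition.\<close>

lemma le_ldiv_pos_iff:
  assumes "\<And>i. x i \<le> 0"
  shows "fl_le (Z_dag n) (neg n x) (pos n f \<setminus>\<^bsub>Z_dag n\<^esub> pos n g) \<longleftrightarrow>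
    (\<forall>j\<in>{1..n}. f j + x (j + 1) \<le> g j)"
proof -
  have "fl_le (Z_dag n) (neg n x) (pos n f \<setminus>\<^bsub>Z_dag n\<^esub> pos n g) \<longleftrightarrow>
      (\<forall>i\<in>{1..n + 1}. 2 \<le> i \<longrightarrow> f (i - 1) + x i \<le> g (i - 1))"
    by (auto simp: Z_dag_ops Z_dag_le assms algebra_simps)
  also have "\<dots> \<longleftrightarrow> (\<forall>i\<in>Suc ` {1..n}. f (i - 1) + x i \<le> g (i - 1))"
    by (auto simp: image_Suc_atLeastAtMost)
  finally show ?thesis
    by (simp del: image_Suc_atLeastAtMost)
qed

lemma pos_le_div_pos:
  "fl_le (Z_dag n) (pos n h) (pos n f \<setminus>\<^bsub>Z_dag n\<^esub> pos n g)"
  "fl_le (Z_dag n) (pos n h) (pos n g \<^bold>/\<^bsub>Z_dag n\<^esub> pos n f)"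
  by (simp_all add: Z_dag_ops Z_dag_le)

lemma le_rdiv_pos_iff:
  assumes "\<And>i. x i \<le> 0"
  shows "fl_le (Z_dag n) (neg n x) (pos n g \<^bold>/\<^bsub>Z_dag n\<^esub> pos n f) \<longleftrightarrow>
    (\<forall>j\<in>{1..n}. x j + f j \<le> g j)"
  by (auto simp: Z_dag_ops Z_dag_le assms) (smt (verit) assms atLeastAtMost_iff)+

lemma pseudo_BL_Z_dag: "pseudo_BL_algebra (Z_dag n)"
proof unfold_locales
  fix x y z
  assume c: "x \<in> carrier (Z_dag n)" "y \<in> carrier (Z_dag n)" "z \<in> carrier (Z_dag n)"
  show "x \<otimes>\<^bsub>Z_dag n\<^esub> y \<otimes>\<^bsub>Z_dag n\<^esub> z = x \<otimes>\<^bsub>Z_dag n\<^esub> (y \<otimes>\<^bsub>Z_dag n\<^esub> z)"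
    using c by (elim Z_dag_cases; simp add: Z_dag_simps; smt (verit))
  show "(x \<^bold>\<and>\<^bsub>Z_dag n\<^esub> y) \<^bold>\<and>\<^bsub>Z_dag n\<^esub> z = x \<^bold>\<and>\<^bsub>Z_dag n\<^esub> (y \<^bold>\<and>\<^bsub>Z_dag n\<^esub> z)"
    using c by (elim Z_dag_cases; simp add: Z_dag_simps min.assoc)
  show "(x \<^bold>\<or>\<^bsub>Z_dag n\<^esub> y) \<^bold>\<or>\<^bsub>Z_dag n\<^esub> z = x \<^bold>\<or>\<^bsub>Z_dag n\<^esub> (y \<^bold>\<or>\<^bsub>Z_dag n\<^esub> z)"
    using c by (elim Z_dag_cases; simp add: Z_dag_simps max.assoc)
  \<comment> \<open>The explicit formula for dividing \<open>pos\<close> by \<open>pos\<close> is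
    withheld from simplification here and in the next claim, so that the characterizations by
    \<open>j\<close> in \<open>{1..n}\<close> apply.\<close>
  show "fl_le (Z_dag n) (x \<otimes>\<^bsub>Z_dag n\<^esub> y) z \<longleftrightarrow> fl_le (Z_dag n) y (x \<setminus>\<^bsub>Z_dag n\<^esub> z)"
    using c
    by (elim Z_dag_cases;
        auto simp: Z_dag_ops Z_dag_le le_ldiv_pos_iff pos_le_div_pos algebra_simps simp del: Z_dag_ops(18))
  show "fl_le (Z_dag n) (x \<otimes>\<^bsub>Z_dag n\<^esub> y) z \<longleftrightarrow> fl_le (Z_dag n) x (z \<^bold>/\<^bsub>Z_dag n\<^esub> y)"
    using c
    by (elim Z_dag_cases;
        auto simp: Z_dag_ops Z_dag_le le_rdiv_pos_iff pos_le_div_pos algebra_simps simp del: Z_dag_ops(22))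
next
  fix x y
  assume "x \<in> carrier (Z_dag n)" "y \<in> carrier (Z_dag n)"
  then show "x \<otimes>\<^bsub>Z_dag n\<^esub> (x \<setminus>\<^bsub>Z_dag n\<^esub> (x \<^bold>\<and>\<^bsub>Z_dag n\<^esub> y)) = x \<^bold>\<and>\<^bsub>Z_dag n\<^esub> y"
    "((x \<^bold>\<and>\<^bsub>Z_dag n\<^esub> y) \<^bold>/\<^bsub>Z_dag n\<^esub> x) \<otimes>\<^bsub>Z_dag n\<^esub> x = x \<^bold>\<and>\<^bsub>Z_dag n\<^esub> y"
    "(x \<setminus>\<^bsub>Z_dag n\<^esub> y) \<^bold>\<or>\<^bsub>Z_dag n\<^esub> (y \<setminus>\<^bsub>Z_dag n\<^esub> x) = \<one>\<^bsub>Z_dag n\<^esub>"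
    "(y \<^bold>/\<^bsub>Z_dag n\<^esub> x) \<^bold>\<or>\<^bsub>Z_dag n\<^esub> (x \<^bold>/\<^bsub>Z_dag n\<^esub> y) = \<one>\<^bsub>Z_dag n\<^esub>"
    "(x \<setminus>\<^bsub>Z_dag n\<^esub> y) \<in> carrier (Z_dag n)"
    "(x \<^bold>/\<^bsub>Z_dag n\<^esub> y) \<in> carrier (Z_dag n)"
    "(x \<^bold>\<and>\<^bsub>Z_dag n\<^esub> y) \<in> carrier (Z_dag n)"
    "(x \<^bold>\<or>\<^bsub>Z_dag n\<^esub> y) \<in> carrier (Z_dag n)"
    "(x \<otimes>\<^bsub>Z_dag n\<^esub> y) \<in> carrier (Z_dag n)"
    "x \<^bold>\<and>\<^bsub>Z_dag n\<^esub> y = y \<^bold>\<and>\<^bsub>Z_dag n\<^esub> x"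
    "x \<^bold>\<or>\<^bsub>Z_dag n\<^esub> y = y \<^bold>\<or>\<^bsub>Z_dag n\<^esub> x"
    "x \<^bold>\<and>\<^bsub>Z_dag n\<^esub> (x \<^bold>\<or>\<^bsub>Z_dag n\<^esub> y) = x"
    "x \<^bold>\<or>\<^bsub>Z_dag n\<^esub> (x \<^bold>\<and>\<^bsub>Z_dag n\<^esub> y) = x"
    by (elim Z_dag_cases; simp add: Z_dag_simps; smt (verit))+
next
  fix x assume "x \<in> carrier (Z_dag n)"
  then show "\<one>\<^bsub>Z_dag n\<^esub> \<otimes>\<^bsub>Z_dag n\<^esub> x = x" "x \<otimes>\<^bsub>Z_dag n\<^esub> \<one>\<^bsub>Z_dag n\<^esub> = x"
    "fl_le (Z_dag n) (fl_zero (Z_dag n)) x" "fl_le (Z_dag n) x \<one>\<^bsub>Z_dag n\<^esub>"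
    by (elim Z_dag_cases; simp add: Z_dag_simps fl_le_def)+
qed (simp_all add: Z_dag_simps)

lemma fl_structure_Z_dag: "fl_structure (Z_dag n)"
proof -
  interpret pseudo_BL_algebra "Z_dag n" by (rule pseudo_BL_Z_dag)
  show ?thesis by unfold_locales
qed


section \<open>Coordinates as terms\<close>

text \<open>On a value \<open>neg n x\<close>, \<open>up\<close> puts \<open>0\<close> in coordinate
  1 and loses coordinate \<open>n + 1\<close>; \<open>down\<close> puts \<open>0\<close> in
  coordinate \<open>n + 1\<close> and loses coordinate 1.\<close>

definition up :: "fl_term \<Rightarrow> fl_term" where
  "up t = Ldiv (Ldiv t Zero) Zero"

definition down :: "fl_term \<Rightarrow> fl_term" where
  "down t = Rdiv Zero (Rdiv Zero t)"

lemma fl_eval_up_pow: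
  assumes "fl_eval (Z_dag n) v t = neg n x" "\<And>i. x i \<le> 0"
  shows "fl_eval (Z_dag n) v ((up ^^ k) t) = neg n (\<lambda>i. if i \<le> k then 0 else x (i - k))"
proof (induction k)
  case 0
  then show ?case by (simp add: assms neg_eq_iff)
next
  case (Suc k)
  then show ?case
    using assms(2) by (auto simp: up_def Z_dag_simps min_def)
qed

lemma fl_eval_down_pow:
  assumes "fl_eval (Z_dag n) v t = neg n x" "\<And>i. x i \<le> 0"
  shows "fl_eval (Z_dag n) v ((down ^^ k) t) = neg n (\<lambda>i. if i + k \<le> n + 1 then x (i + k) else 0)"
proof (induction k)
  case 0
  then show ?case by (simp add: assms neg_eq_iff)
next
  case (Suc k)
  then show ?case
    using assms(2) by (auto simp: down_def Z_dag_simps min_def)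
qed

definition last_unit :: "nat \<Rightarrow> int \<Rightarrow> (nat, nat, int) kite" where
  "last_unit n a = neg n (\<lambda>i. if i = n + 1 then a else 0)"

text \<open>The downward shifts bring coordinate \<open>j\<close> to place 1; the \<open>n\<close>
  upward shifts then carry it to place \<open>n + 1\<close> and push all others out. Every
  coordinate thus ends in the common form \<open>last_unit\<close>.\<close>

definition coord :: "nat \<Rightarrow> nat \<Rightarrow> fl_term \<Rightarrow> fl_term" where
  "coord n j t = (up ^^ n) ((down ^^ (j - 1)) t)"

lemma fl_eval_coord:
  assumes "fl_eval (Z_dag n) v t = neg n x" "\<And>i. x i \<le> 0" "j \<in> {1..n + 1}"
  shows "fl_eval (Z_dag n) v (coord n j t) = last_unit n (x j)"
  unfolding coord_def last_unit_def
  by (subst fl_eval_up_pow[OF fl_eval_down_pow[OF assms(1,2)]])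
    (use assms(2,3) in \<open>auto simp: neg_eq_iff\<close>)

text \<open>Shifting down by \<open>n - m\<close> moves an entry from place \<open>n + 1\<close> to
  place \<open>m + 1\<close>, and multiplication adds coordinates, so the factors fill the sequence
  from left to right.\<close>

primrec assemble :: "nat \<Rightarrow> (nat \<Rightarrow> fl_term) \<Rightarrow> nat \<Rightarrow> fl_term" where
  "assemble n T 0 = One"
| "assemble n T (Suc m) = Mult (assemble n T m) ((down ^^ (n - m)) (T (Suc m)))"

lemma fl_eval_assemble:
  assumes "\<And>j. j \<in> {1..n + 1} \<Longrightarrow> fl_eval (Z_dag n) v (T j) = last_unit n (x j)"
    and "\<And>i. x i \<le> 0"
  shows "fl_eval (Z_dag n) v (assemble n T (n + 1)) = neg n x"
proof -
  have "fl_eval (Z_dag n) v (assemble n T m) = neg n (\<lambda>i. if i \<le> m then x i else 0)"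
    if "m \<le> n + 1" for m
    using that
  proof (induction m)
    case 0
    then show ?case by (simp add: Z_dag_simps)
  next
    case (Suc m)
    have "fl_eval (Z_dag n) v ((down ^^ (n - m)) (T (Suc m))) =
        neg n (\<lambda>i. if i + (n - m) \<le> n + 1 then (if i + (n - m) = n + 1 then x (Suc m) else 0) else 0)"
      by (rule fl_eval_down_pow) (use Suc.prems assms in \<open>auto simp: last_unit_def\<close>)
    then show ?case
      using Suc by (auto simp: Z_dag_simps le_Suc_eq)
  qed
  from this[of "n + 1"] show ?thesis
    by (simp add: neg_eq_iff)
qed

text \<open>Powers of the generator give every \<open>last_unit n (- k)\<close>, and assembling
  these gives the negative cone. The positive cone consists of the elements
  \<open>t \<setminus> 0\<close> with \<open>t\<close> over the negative cone.\<close>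

lemma Z_dag_one_generated:
  assumes "u \<in> carrier (Z_dag n)"
  shows "\<exists>t. fl_eval (Z_dag n) (\<lambda>_. last_unit n (- 1)) t = u"
proof -
  let ?v = "\<lambda>_::nat. last_unit n (- 1)"
  have pow: "fl_eval (Z_dag n) ?v ((Mult (Var 0) ^^ k) One) = last_unit n (- int k)" for k
    by (induction k) (auto simp: last_unit_def Z_dag_simps)
  have gen: "\<exists>t. fl_eval (Z_dag n) ?v t = neg n x" if "\<And>i. x i \<le> 0" for x
    using that pow
    by (intro exI[of _ "assemble n (\<lambda>j. (Mult (Var 0) ^^ nat (- x j)) One) (n + 1)"] fl_eval_assemble) simp_all
  show ?thesis
    using assms
  proof (cases rule: Z_dag_cases)
    case (neg x)
    then show ?thesis using gen by simp
  next
    case (pos f)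
    then obtain t where "fl_eval (Z_dag n) ?v t = neg n (\<lambda>i. - f i)"
      using gen[of "\<lambda>i. - f i"] by auto
    then have "fl_eval (Z_dag n) ?v (Ldiv t Zero) = u"
      using pos by (simp add: Z_dag_simps)
    then show ?thesis by blast
  qed
qed

instance fl_term :: countable
  by countable_datatype

lemma countable_Z_dag: "countable (carrier (Z_dag n))"
proof (rule countable_subset)
  show "carrier (Z_dag n) \<subseteq> range (fl_eval (Z_dag n) (\<lambda>_. last_unit n (- 1)))"
    using Z_dag_one_generated by blast
qed simp

section \<open>Scaling endomorphisms and detecting terms\<close>

definition scale :: "nat \<Rightarrow> int \<Rightarrow> (nat, nat, int) kite \<Rightarrow> (nat, nat, int) kite" where
  "scale n m u = (case u of Inl f \<Rightarrow> pos n (\<lambda>j. m * f j) | Inr x \<Rightarrow> neg n (\<lambda>i. m * x i))"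

lemma scale_neg: "scale n m (neg n x) = neg n (\<lambda>i. m * x i)"
  and scale_pos: "scale n m (pos n f) = pos n (\<lambda>j. m * f j)"
  by (auto simp: scale_def neg_def pos_def restrict_def fun_eq_iff)

lemma scale_last_unit: "scale n m (last_unit n (- 1)) = last_unit n (- m)"
  by (auto simp: last_unit_def scale_neg neg_eq_iff)

text \<open>All operations are built from sums, differences, minima, maxima and \<open>0\<close>,
  which commute with multiplication by a nonnegative integer.\<close>

lemma fl_hom_scale:
  assumes "0 \<le> m"
  shows "fl_hom (Z_dag n) (Z_dag n) (scale n m)"
proof -
  have mult_min: "m * min a b = min (m * a) (m * b)" and mult_max: "m * max a b = max (m * a) (m * b)" for a b
    using assms by (auto simp: min_def max_def mult_le_cancel_left)
  have neg: "m * a \<le> 0" if "a \<le> 0" for a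
    using assms that by (simp add: mult_nonneg_nonpos)
  have if_mult: "m * (if c then a else 0) = (if c then m * a else 0)" for c a
    by simp
  show ?thesis
    unfolding fl_hom_def
  proof (intro conjI ballI)
    show "scale n m ` carrier (Z_dag n) \<subseteq> carrier (Z_dag n)"
      using assms neg by (auto elim!: Z_dag_cases simp: scale_neg scale_pos neg_in_Z_dag pos_in_Z_dag)
  qed (auto elim!: Z_dag_cases
      simp: scale_neg scale_pos Z_dag_simps mult_min mult_max if_mult algebra_simps)
qed

text \<open>\<open>e\<close> is always \<open>1\<close> in \<open>A\<close>, yet in the kite it is
  below every multiple of the generator at which it is evaluated. It measures the failure of the
  identity uniformly in \<open>m\<close>.\<close>

lemma detecting_term:
  assumes A: "pseudo_BL_algebra A" and stA: "(s, t) \<in> fl_theory A" and stZ: "(s, t) \<notin> fl_theory (Z_dag n)"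
  obtains e where
    "\<And>m. 0 \<le> m \<Longrightarrow> fl_le (Z_dag n) (fl_eval (Z_dag n) (\<lambda>_. last_unit n (- m)) e) (last_unit n (- m))"
    and "\<And>w. range w \<subseteq> carrier A \<Longrightarrow> fl_eval A w e = \<one>\<^bsub>A\<^esub>"
proof -
  interpret A: pseudo_BL_algebra A by fact
  interpret Z: pseudo_BL_algebra "Z_dag n" by (rule pseudo_BL_Z_dag)
  have strA: "fl_structure A" by unfold_locales
  let ?u = "\<lambda>m. (\<lambda>_::nat. last_unit n (- m))"
  obtain v where v: "range v \<subseteq> carrier (Z_dag n)" "fl_eval (Z_dag n) v s \<noteq> fl_eval (Z_dag n) v t"
    using stZ by (auto simp: fl_theory_def)
  have "\<forall>k. \<exists>r. fl_eval (Z_dag n) (?u 1) r = v k"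
    using v(1) Z_dag_one_generated by blast
  then obtain \<sigma> where \<sigma>: "\<And>k. fl_eval (Z_dag n) (?u 1) (\<sigma> k) = v k"
    by metis
  \<comment> \<open>The variables are replaced by terms in the generator for the values at which the
    identity fails, and the biresidual joins both sides into one term.\<close>
  define d where
    "d = Meet (Ldiv (fl_subst \<sigma> s) (fl_subst \<sigma> t)) (Ldiv (fl_subst \<sigma> t) (fl_subst \<sigma> s))"
  have closed: "range (?u m) \<subseteq> carrier (Z_dag n)" if "0 \<le> m" for m
    using that by (auto simp: last_unit_def neg_in_Z_dag)
  have d_A: "fl_eval A w d = \<one>\<^bsub>A\<^esub>" if w: "range w \<subseteq> carrier A" for w
  proof -
    have "range (\<lambda>k. fl_eval A w (\<sigma> k)) \<subseteq> carrier A"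
      using fl_eval_closed[OF strA w] by auto
    then have "fl_eval A w (fl_subst \<sigma> s) = fl_eval A w (fl_subst \<sigma> t)"
      using stA by (simp add: fl_theory_def fl_eval_subst)
    then show ?thesis
      unfolding d_def using fl_eval_closed[OF strA w] by (simp add: A.biresidual_eq_one_iff)
  qed
  have d_scale: "fl_eval (Z_dag n) (?u m) d = scale n m (fl_eval (Z_dag n) (?u 1) d)" if "0 \<le> m" for m
    using fl_eval_hom[OF fl_structure_Z_dag fl_hom_scale[OF that] closed[of 1], of d]
    by (simp add: scale_last_unit)
  have d_neq: "fl_eval (Z_dag n) (?u 1) d \<noteq> \<one>\<^bsub>Z_dag n\<^esub>"
    using v(2) fl_eval_closed[OF fl_structure_Z_dag v(1)]
    by (simp add: d_def fl_eval_subst \<sigma> Z.biresidual_eq_one_iff)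
  have "fl_eval (Z_dag n) (?u 1) d \<in> carrier (Z_dag n)"
    by (rule fl_eval_closed[OF fl_structure_Z_dag closed]) simp
  then show thesis
  proof (cases rule: Z_dag_cases)
    case (neg x)
    then obtain i where i: "i \<in> {1..n + 1}" "x i \<noteq> 0"
      using d_neq by (auto simp: Z_dag_simps)
    \<comment> \<open>Discreteness of the integers: a nonzero nonpositive coordinate is at most
      \<open>- 1\<close>, hence at most \<open>- m\<close> after scaling.\<close>
    then have "x i \<le> - 1" using neg(2)[of i] by simp
    show thesis
    proof (rule that[of "coord n i d"])
      fix m :: int assume m: "0 \<le> m"
      have "fl_eval (Z_dag n) (?u m) d = neg n (\<lambda>i. m * x i)"
        using d_scale[OF m] by (simp only: neg scale_neg)
      then have "fl_eval (Z_dag n) (?u m) (coord n i d) = last_unit n (m * x i)"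
        by (rule fl_eval_coord) (use m neg(2) i in \<open>simp_all add: mult_nonneg_nonpos\<close>)
      moreover have "m * x i \<le> - m"
        using mult_left_mono[OF \<open>x i \<le> - 1\<close> m] by simp
      ultimately show "fl_le (Z_dag n) (fl_eval (Z_dag n) (?u m) (coord n i d)) (last_unit n (- m))"
        by (simp add: last_unit_def Z_dag_le)
    next
      fix w :: "nat \<Rightarrow> 'a" assume w: "range w \<subseteq> carrier A"
      \<comment> \<open>Both double negations fix \<open>1\<close>, so isolating a coordinate keeps
        the value \<open>1\<close> in \<open>A\<close>.\<close>
      have down: "fl_eval A w ((down ^^ k) d) = \<one>\<^bsub>A\<^esub>" for k
        by (induction k)
          (simp_all add: d_A[OF w] down_def A.rdiv_one A.rdiv_eq_one_iff A.zero_in A.le_refl)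
      have "fl_eval A w ((up ^^ k) ((down ^^ l) d)) = \<one>\<^bsub>A\<^esub>" for k l
        by (induction k)
          (simp_all add: down up_def A.one_ldiv A.ldiv_eq_one_iff A.zero_in A.le_refl)
      then show "fl_eval A w (coord n i d) = \<one>\<^bsub>A\<^esub>"
        by (simp add: coord_def)
    qed
  next
    case (pos f)
    \<comment> \<open>The positive cone lies below the negative cone, so \<open>d\<close> itself
      serves.\<close>
    show thesis
    proof (rule that[of d])
      fix m :: int assume "0 \<le> m"
      then have "fl_eval (Z_dag n) (?u m) d = pos n (\<lambda>j. m * f j)"
        using d_scale[of m] by (simp only: pos(1) scale_pos)
      moreover have "fl_le (Z_dag n) (pos n (\<lambda>j. m * f j)) (last_unit n (- m))"
        by (simp add: last_unit_def Z_dag_le)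
      ultimately show "fl_le (Z_dag n) (fl_eval (Z_dag n) (?u m) d) (last_unit n (- m))"
        by (simp only:)
    qed (rule d_A)
  qed
qed

section \<open>Excluded middle and the dichotomy for members of the variety\<close>

definition em :: fl_term where
  "em = Join (Var 0) (Ldiv (Var 0) Zero)"

text \<open>Exactly one of an element and its negation lies over the negative cone, and the join is
  that one.\<close>

lemma fl_eval_em:
  assumes "v 0 \<in> carrier (Z_dag n)"
  obtains x where "fl_eval (Z_dag n) v em = neg n x" "\<And>i. x i \<le> 0"
  using assms
proof (cases rule: Z_dag_cases)
  case (neg x)
  then show thesis
    using that by (auto simp: em_def Z_dag_ops)
next
  case (pos f)
  then show thesis
    using that by (auto simp: em_def Z_dag_ops)
qed

text \<open>This yields minimality: a member of the variety of \<open>Z_dag n\<close> whose theory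
  is too large to generate it satisfies every coordinate of excluded middle, hence excluded
  middle.\<close>

lemma boolean_or_generates:
  assumes A: "pseudo_BL_algebra A" and Z_A: "fl_theory (Z_dag n) \<subseteq> fl_theory A"
    and not_le: "\<not> fl_theory A \<subseteq> fl_theory (Z_dag n)"
  shows "fl_theory two \<subseteq> fl_theory A"
proof -
  interpret A: pseudo_BL_algebra A by fact
  have strA: "fl_structure A" by unfold_locales
  obtain s t where "(s, t) \<in> fl_theory A" "(s, t) \<notin> fl_theory (Z_dag n)"
    using not_le by auto
  from detecting_term[OF A this] obtain e where
    e_le: "\<And>m. 0 \<le> m \<Longrightarrow> fl_le (Z_dag n) (fl_eval (Z_dag n) (\<lambda>_. last_unit n (- m)) e) (last_unit n (- m))"
    and e_one: "\<And>w. range w \<subseteq> carrier A \<Longrightarrow> fl_eval A w e = \<one>\<^bsub>A\<^esub>"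
    by blast
  let ?T = "\<lambda>j. coord n j em"
  have em_one: "fl_eval A v em = \<one>\<^bsub>A\<^esub>" if v: "range v \<subseteq> carrier A" for v
  proof -
    have T_one: "fl_eval A v (?T j) = \<one>\<^bsub>A\<^esub>" if j: "j \<in> {1..n + 1}" for j
    proof -
      \<comment> \<open>In the kite the coordinate has the value \<open>last_unit n (- m)\<close>
        with \<open>m = - x j\<close>, so \<open>e\<close> applied to it is below it. This is the
        identity \<open>e \<and> c = e\<close>; in \<open>A\<close>, where \<open>e = 1\<close>, it
        forces \<open>c = 1\<close>.\<close>
      let ?e = "fl_subst (\<lambda>_. ?T j) e"
      have "fl_eval A v (Meet ?e (?T j)) = fl_eval A v ?e"
      proof (rule theory_transfer[OF Z_A v])
        fix w :: "nat \<Rightarrow> (nat, nat, int) kite" assume "range w \<subseteq> carrier (Z_dag n)"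
        then obtain x where x: "fl_eval (Z_dag n) w em = neg n x" "\<And>i. x i \<le> 0"
          by (meson fl_eval_em rangeI subsetD)
        have "fl_eval (Z_dag n) w (?T j) = last_unit n (x j)"
          by (rule fl_eval_coord[OF x j])
        then show "fl_eval (Z_dag n) w (Meet ?e (?T j)) = fl_eval (Z_dag n) w ?e"
          using e_le[of "- x j"] x(2)[of j] by (simp add: fl_eval_subst fl_le_def)
      qed
      moreover have "fl_eval A v ?e = \<one>\<^bsub>A\<^esub>"
        using fl_eval_closed[OF strA v] by (auto simp: fl_eval_subst intro: e_one)
      ultimately show ?thesis
        using fl_eval_closed[OF strA v] by (simp add: A.one_meet)
    qed
    \<comment> \<open>That \<open>em\<close> is put together from its coordinates is an identity of
      the kite, and so holds in \<open>A\<close>.\<close>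
    have "fl_eval A v em = fl_eval A v (assemble n ?T (n + 1))"
    proof (rule theory_transfer[OF Z_A v])
      fix w :: "nat \<Rightarrow> (nat, nat, int) kite" assume "range w \<subseteq> carrier (Z_dag n)"
      then obtain x where x: "fl_eval (Z_dag n) w em = neg n x" "\<And>i. x i \<le> 0"
        by (meson fl_eval_em rangeI subsetD)
      have "fl_eval (Z_dag n) w (assemble n ?T (n + 1)) = neg n x"
        by (rule fl_eval_assemble) (simp_all add: fl_eval_coord[OF x] x(2))
      then show "fl_eval (Z_dag n) w em = fl_eval (Z_dag n) w (assemble n ?T (n + 1))"
        by (simp add: x)
    qed
    moreover have "fl_eval A v (assemble n ?T m) = \<one>\<^bsub>A\<^esub>" if "m \<le> n + 1" for m
      using that
    proof (induction m)
      case (Suc m)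
      have "fl_eval A v ((down ^^ k) (?T (Suc m))) = \<one>\<^bsub>A\<^esub>" for k
        using Suc.prems
        by (induction k)
          (simp_all add: T_one down_def A.rdiv_one A.rdiv_eq_one_iff A.zero_in A.le_refl)
      then show ?case
        using Suc by (simp add: A.one_in)
    qed simp
    ultimately show ?thesis
      by (simp del: assemble.simps)
  qed
  show ?thesis
  proof (rule A.theory_two_if_excluded_middle)
    fix x assume "x \<in> carrier A"
    then show "x \<^bold>\<or>\<^bsub>A\<^esub> (x \<setminus>\<^bsub>A\<^esub> fl_zero A) = \<one>\<^bsub>A\<^esub>"
      using em_one[of "\<lambda>_. x"] by (auto simp: em_def)
  qed
qed

section \<open>The cover and the separation of the varieties\<close>

lemma theory_Z_dag_subset_theory_two: "fl_theory (Z_dag n) \<subseteq> fl_theory two"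
proof -
  \<comment> \<open>The bounds of the kite form a subalgebra that is a copy of
    \<open>two\<close>.\<close>
  let ?h = "\<lambda>b. if b then \<one>\<^bsub>Z_dag n\<^esub> else fl_zero (Z_dag n)"
  have "fl_structure two"
    by unfold_locales (auto simp: two_def)
  moreover have "fl_hom two (Z_dag n) ?h"
    by (auto simp: fl_hom_def two_def Z_dag_simps)
  moreover have "inj_on ?h (carrier two)"
    by (auto simp: inj_on_def Z_dag_ops)
  ultimately have "satisfies two (fl_theory (Z_dag n))"
    by (rule satisfies_if_embeds) (simp add: satisfies_iff_theory)
  then show ?thesis by (simp add: satisfies_iff_theory)
qed

lemma em_in_theory_two: "(em, One) \<in> fl_theory two"
  by (auto simp: fl_theory_def em_def two_def)

text \<open>Each upward shift clears one more coordinate, so \<open>n + 1\<close> shifts are needed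
  to clear all of them. The theory therefore determines \<open>n\<close>; with \<open>k = 0\<close>
  it also shows that excluded middle fails.\<close>

lemma up_pow_em_in_theory_iff: "((up ^^ k) em, One) \<in> fl_theory (Z_dag n) \<longleftrightarrow> n < k"
proof
  assume mem: "((up ^^ k) em, One) \<in> fl_theory (Z_dag n)"
  \<comment> \<open>All entries are \<open>- 1\<close>, so after \<open>n\<close> or fewer shifts
    the last place still holds \<open>- 1\<close>.\<close>
  let ?v = "\<lambda>_::nat. neg n (\<lambda>_. - 1)"
  have v: "range ?v \<subseteq> carrier (Z_dag n)"
    by (auto simp: neg_in_Z_dag)
  have "fl_eval (Z_dag n) ?v em = neg n (\<lambda>_. - 1)"
    by (simp add: em_def Z_dag_ops)
  then have "fl_eval (Z_dag n) ?v ((up ^^ k) em) = neg n (\<lambda>i. if i \<le> k then 0 else - 1)"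
    by (rule fl_eval_up_pow) simp
  moreover have "fl_eval (Z_dag n) ?v ((up ^^ k) em) = neg n (\<lambda>_. 0)"
    using mem v by (auto simp: fl_theory_def Z_dag_ops)
  ultimately have "\<forall>i\<in>{1..n + 1}. i \<le> k"
    by (simp add: neg_eq_iff split: if_splits)
  then show "n < k"
    by (auto dest: bspec[of _ _ "n + 1"])
next
  assume "n < k"
  show "((up ^^ k) em, One) \<in> fl_theory (Z_dag n)"
    unfolding fl_theory_def
  proof clarify
    fix v :: "nat \<Rightarrow> (nat, nat, int) kite" assume "range v \<subseteq> carrier (Z_dag n)"
    then obtain x where x: "fl_eval (Z_dag n) v em = neg n x" "\<And>i. x i \<le> 0"
      by (meson fl_eval_em rangeI subsetD)
    show "fl_eval (Z_dag n) v ((up ^^ k) em) = fl_eval (Z_dag n) v One"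
      using \<open>n < k\<close> by (simp add: fl_eval_up_pow[OF x] Z_dag_simps)
  qed
qed

lemma variety_gen_Z_dag_covers_BA:
  assumes inf: "infinite (UNIV :: 'u set)"
  shows "variety_covers (variety_gen (Z_dag n) :: 'u fl set) BA"
  unfolding variety_covers_def
proof (intro conjI notI)
  show "pseudo_BL_variety (BA :: 'u fl set)"
    unfolding BA_def by (rule pseudo_BL_variety_gen[OF pseudo_BL_two])
  show W: "pseudo_BL_variety (variety_gen (Z_dag n) :: 'u fl set)"
    by (rule pseudo_BL_variety_gen[OF pseudo_BL_Z_dag])
  have "(BA :: 'u fl set) \<subseteq> variety_gen (Z_dag n)"
    using theory_Z_dag_subset_theory_two[of n] unfolding BA_def
    by (meson order.trans subsetI variety_gen_iff)
  moreover have "\<not> fl_theory two \<subseteq> fl_theory (Z_dag n)"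
    using em_in_theory_two up_pow_em_in_theory_iff[of 0 n] by auto
  then have "\<not> (variety_gen (Z_dag n) :: 'u fl set) \<subseteq> BA"
    unfolding BA_def variety_gen_le_iff[OF inf fl_structure_Z_dag countable_Z_dag] .
  ultimately show "(BA :: 'u fl set) \<subset> variety_gen (Z_dag n)"
    by blast
  assume "\<exists>U :: 'u fl set. pseudo_BL_variety U \<and> BA \<subset> U \<and> U \<subset> variety_gen (Z_dag n)"
  then obtain U :: "'u fl set" where U: "variety U" "BA \<subset> U" "U \<subset> variety_gen (Z_dag n)"
    by (auto simp: pseudo_BL_variety_def)
  then obtain A where A: "A \<in> U" "A \<notin> BA" "A \<in> variety_gen (Z_dag n)"
    by blast
  have bl: "pseudo_BL_algebra A"
    using W A(3) by (simp add: pseudo_BL_variety_def)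
  \<comment> \<open>As \<open>A\<close> is not Boolean, all its identities hold in the kite. The
    identities defining \<open>U\<close> are among them, so \<open>U\<close> contains the whole
    variety.\<close>
  have "fl_theory A \<subseteq> fl_theory (Z_dag n)"
    using boolean_or_generates[OF bl] A(2,3) unfolding BA_def variety_gen_iff by blast
  moreover obtain E where "U = Mod E"
    using U(1) by (auto simp: variety_def)
  ultimately have "satisfies (Z_dag n) E"
    using A(1) by (auto simp: Mod_def satisfies_iff_theory)
  then have "variety_gen (Z_dag n) \<subseteq> U"
    using \<open>U = Mod E\<close> by (auto simp: variety_gen_def)
  then show False using U(3) by blast
qed

theorem theorem7p2:
  assumes "infinite (UNIV :: 'u set)"
  shows "(\<forall>n\<ge>1. variety_covers (variety_gen (Z_dag n) :: 'u fl set) BA) \<and>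
    (\<forall>n\<ge>1. \<forall>m\<ge>1. n \<noteq> m \<longrightarrow>
      (variety_gen (Z_dag n) :: 'u fl set) \<noteq> variety_gen (Z_dag m))"
proof (intro conjI allI impI notI)
  fix n m :: nat
  assume "n \<noteq> m" and eq: "(variety_gen (Z_dag n) :: 'u fl set) = variety_gen (Z_dag m)"
  have "fl_theory (Z_dag n) = fl_theory (Z_dag m)"
    using eq variety_gen_le_iff[OF assms fl_structure_Z_dag countable_Z_dag] by blast
  \<comment> \<open>Equal theories have the same threshold for the number of shifts that send
    \<open>em\<close> to \<open>1\<close>.\<close>
  then have "n < k \<longleftrightarrow> m < k" for k
    using up_pow_em_in_theory_iff by metis
  then show False
    using \<open>n \<noteq> m\<close> by (meson linorder_neqE_nat less_irrefl)
qed (rule variety_gen_Z_dag_covers_BA[OF assms])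

end
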